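(* Let $(X,d)$ be a proper geodesic Gromov hyperbolic metric space, and let $f\colon X\to X$ be a non-expanding map. Assume that $\eta\in\partial_GX$ is a repelling boundary regular fixed point of $f$, i.e. a boundary regular fixed point with stable dilation $\Lambda_\eta>1$. Then there exists a backward orbit $(x_n)_{n\ge 0}$ of $f$ (with bounded step) converging to $\eta$ with backward step rate $b(x_n)=\log\Lambda_\eta$.
   Context: $f$ is non-expanding if $d(f(x),f(y))\le d(x,y)$ for all $x,y$. $X$ is $\delta$-hyperbolic ($\delta>0$) if in every geodesic triangle each side is contained in the $\delta$-neighborhood of the union of the other two; Gromov hyperbolic means $\delta$-hyperbolic for some $\delta$. $\partial_GX$ is the Gromov boundary (asymptotic classes of geodesic rays) and $\overline X^G=X\sqcup\partial_GX$ the Gromov compactification; convergence to boundary points is in $\overline X^G$. Geodesic region: for a geodesic ray $\gamma$ and $R>0$, $A(\gamma,R)=\{x\in X: d(x,\gamma)<R\}$, with vertex $[\gamma]\in\partial_GX$. A map $g\colon X\to X$ has geodesic limit $\xi\in\overline X^G$ at $\eta\in\partial_GX$ if $g(x_n)\to\xi$ for every sequence $x_n\to\eta$ contained in a geodesic region with vertex $\eta$. Dilation: for $p\in X$, $\eta\in\partial_GX$, $\log\lambda_{\eta,p}(g)=\liminf_{z\to\eta}\,[d(z,p)-d(g(z),p)]$; finiteness does not depend on $p$. $\eta$ is a boundary regular fixed point (BRFP) of $g$ if $\lambda_{\eta,p}(g)<+\infty$ and $g$ has geodesic limit $\eta$ at $\eta$. A BRFP of $f$ is a BRFP of every iterate $f^n$,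 and the stable dilation $\Lambda_\eta$ is defined by $\log\Lambda_\eta=\lim_{n\to\infty}\frac1n\log\lambda_{\eta,p}(f^n)$ (the limit exists, is finite and is independent of $p$). A backward orbit is a sequence $(x_n)_{n\ge0}$ in $X$ with $f(x_{n+1})=x_n$ for all $n\ge0$; it has bounded step if $\sup_n d(x_n,x_{n+1})<\infty$. For a backward orbit with bounded step, $\sigma_m(x_n)=\lim_{n\to\infty}d(x_n,x_{n+m})$ (a non-decreasing limit), and the backward step rate is $b(x_n)=\lim_{m\to\infty}\sigma_m(x_n)/m=\inf_m\sigma_m(x_n)/m$. *)

theory Defs
  imports "HOL-Analysis.Analysis"
begin

section \<open>Proper geodesic Gromov hyperbolic spaces\<close>

definition proper_space :: "'a::metric_space itself \<Rightarrow> bool" where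
  "proper_space _ \<longleftrightarrow> (\<forall>(x::'a) r. compact (cball x r))"

definition geodesic_segment :: "'a::metric_space \<Rightarrow> 'a \<Rightarrow> 'a set \<Rightarrow> bool" where
  "geodesic_segment x y S \<longleftrightarrow>
     (\<exists>\<gamma>::real \<Rightarrow> 'a. \<gamma> 0 = x \<and> \<gamma> (dist x y) = y \<and>
        (\<forall>s\<in>{0..dist x y}. \<forall>t\<in>{0..dist x y}. dist (\<gamma> s) (\<gamma> t) = \<bar>s - t\<bar>) \<and>
        S = \<gamma> ` {0..dist x y})"

definition geodesic_space :: "'a::metric_space itself \<Rightarrow> bool" where
  "geodesic_space _ \<longleftrightarrow> (\<forall>(x::'a) y. \<exists>S. geodesic_segment x y S)"

definition metric_nbhd :: "real \<Rightarrow> 'a::metric_space set \<Rightarrow> 'a set" where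
  "metric_nbhd r S = {x. \<exists>y\<in>S. dist x y < r}"

definition delta_hyperbolic :: "'a::metric_space itself \<Rightarrow> real \<Rightarrow> bool" where
  "delta_hyperbolic _ \<delta> \<longleftrightarrow>
     (\<forall>(x::'a) y z S T U.
        geodesic_segment x y S \<and> geodesic_segment y z T \<and> geodesic_segment z x U \<longrightarrow>
        S \<subseteq> metric_nbhd \<delta> (T \<union> U) \<and>
        T \<subseteq> metric_nbhd \<delta> (U \<union> S) \<and>
        U \<subseteq> metric_nbhd \<delta> (S \<union> T))"

definition gromov_hyperbolic :: "'a::metric_space itself \<Rightarrow> bool" where
  "gromov_hyperbolic X \<longleftrightarrow> (\<exists>\<delta>>0. delta_hyperbolic X \<delta>)"

definition non_expanding :: "('a::metric_space \<Rightarrow> 'a) \<Rightarrow> bool" where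
  "non_expanding f \<longleftrightarrow> (\<forall>x y. dist (f x) (f y) \<le> dist x y)"


section \<open>Gromov boundary and Gromov compactification\<close>

text \<open>Rays are parametrised by \<open>[0, \<infinity>)\<close>; the values of the function at negative reals are
  irrelevant for all notions below.\<close>

definition geodesic_rays :: "(real \<Rightarrow> 'a::metric_space) set" where
  "geodesic_rays = {\<gamma>. \<forall>s\<ge>0. \<forall>t\<ge>0. dist (\<gamma> s) (\<gamma> t) = \<bar>s - t\<bar>}"

definition asymptotic_rel :: "((real \<Rightarrow> 'a::metric_space) \<times> (real \<Rightarrow> 'a)) set" where
  "asymptotic_rel = {(\<gamma>, \<gamma>'). \<gamma> \<in> geodesic_rays \<and> \<gamma>' \<in> geodesic_rays \<and>
     (\<exists>C. \<forall>t\<ge>0. dist (\<gamma> t) (\<gamma>' t) \<le> C)}"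

lemma equiv_asymptotic_rel:
  "equiv geodesic_rays (asymptotic_rel :: ((real \<Rightarrow> 'a::metric_space) \<times> _) set)"
proof (rule equivI)
  show "refl_on geodesic_rays (asymptotic_rel :: ((real \<Rightarrow> 'a) \<times> _) set)"
    by (auto simp: refl_on_def asymptotic_rel_def)
  show "sym (asymptotic_rel :: ((real \<Rightarrow> 'a) \<times> _) set)"
    by (auto simp: sym_def asymptotic_rel_def dist_commute)
  show "trans (asymptotic_rel :: ((real \<Rightarrow> 'a) \<times> _) set)"
  proof (rule transI)
    fix \<alpha> \<beta> \<gamma> :: "real \<Rightarrow> 'a"
    assume "(\<alpha>, \<beta>) \<in> asymptotic_rel" "(\<beta>, \<gamma>) \<in> asymptotic_rel"
    then obtain C D where r: "\<alpha> \<in> geodesic_rays" "\<gamma> \<in> geodesic_rays"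
      and b: "\<And>t. t \<ge> 0 \<Longrightarrow> dist (\<alpha> t) (\<beta> t) \<le> C" "\<And>t. t \<ge> 0 \<Longrightarrow> dist (\<beta> t) (\<gamma> t) \<le> D"
      by (auto simp: asymptotic_rel_def)
    have "dist (\<alpha> t) (\<gamma> t) \<le> C + D" if "t \<ge> 0" for t
      using b[OF that] dist_triangle[of "\<alpha> t" "\<gamma> t" "\<beta> t"] by linarith
    with r show "(\<alpha>, \<gamma>) \<in> asymptotic_rel"
      by (auto simp: asymptotic_rel_def)
  qed
qed (auto simp: asymptotic_rel_def)

definition gromov_boundary :: "(real \<Rightarrow> 'a::metric_space) set set" where
  "gromov_boundary = geodesic_rays // asymptotic_rel"

type_synonym 'a gromov_point = "'a + (real \<Rightarrow> 'a) set"

definition gromov_closure :: "'a::metric_space gromov_point set" where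
  "gromov_closure = range Inl \<union> Inr ` gromov_boundary"

definition gromov_product :: "'a::metric_space \<Rightarrow> 'a \<Rightarrow> 'a \<Rightarrow> real" where
  "gromov_product p x y = (dist x p + dist y p - dist x y) / 2"

text \<open>The Gromov product is extended to the boundary as usual, by
  \<open>(\<xi>|\<zeta>)\<^sub>p = sup liminf (x|y)\<^sub>p\<close> for \<open>x \<rightarrow> \<xi>\<close>, \<open>y \<rightarrow> \<zeta>\<close>, where boundary points are approached
  along the geodesic rays representing them and points of the space are kept constant. In a
  hyperbolic space, other ways of approaching boundary points change the value by a bounded
  amount only.\<close>

definition approaches :: "'a::metric_space gromov_point \<Rightarrow> 'a filter set" where
  "approaches \<xi> = (case \<xi> of Inl x \<Rightarrow> {principal {x}} | Inr \<eta> \<Rightarrow> (\<lambda>\<gamma>. filtermap \<gamma> at_top) ` \<eta>)"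

definition ext_gromov_product :: "'a::metric_space \<Rightarrow> 'a gromov_point \<Rightarrow> 'a gromov_point \<Rightarrow> ereal"
  where "ext_gromov_product p \<xi> \<zeta> =
    (SUP F\<in>approaches \<xi>. SUP G\<in>approaches \<zeta>.
       Liminf (F \<times>\<^sub>F G) (\<lambda>(x, y). ereal (gromov_product p x y)))"

text \<open>The topology of the Gromov compactification: it induces the metric topology on the open
  subset \<open>X\<close>, and the sets \<open>{\<xi>. (\<xi>|\<eta>)\<^sub>p > r}\<close> form a neighbourhood base at a boundary point
  \<open>\<eta>\<close>. Changing \<open>p\<close> changes the product by at most the distance of the base points, so
  quantifying over all \<open>p\<close> just avoids a choice.\<close>

definition gromov_open :: "'a::metric_space gromov_point set \<Rightarrow> bool" where
  "gromov_open U \<longleftrightarrow> U \<subseteq> gromov_closure \<and> open (Inl -` U) \<and>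
     (\<forall>\<eta>. Inr \<eta> \<in> U \<longrightarrow>
        (\<forall>p. \<exists>r::real. \<forall>\<xi>\<in>gromov_closure. ext_gromov_product p \<xi> (Inr \<eta>) > ereal r \<longrightarrow> \<xi> \<in> U))"

definition gromov_topology :: "'a::metric_space gromov_point topology" where
  "gromov_topology = topology gromov_open"

lemma istopology_gromov_open: "istopology gromov_open"
  unfolding istopology_def
proof (intro conjI allI impI)
  fix S T :: "'a gromov_point set"
  assume S: "gromov_open S" and T: "gromov_open T"
  show "gromov_open (S \<inter> T)"
    unfolding gromov_open_def
  proof (intro conjI allI impI)
    show "S \<inter> T \<subseteq> gromov_closure" "open (Inl -` (S \<inter> T))"
      using S T by (auto simp: gromov_open_def)
  next
    fix \<eta> p assume "Inr \<eta> \<in> S \<inter> T"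
    then obtain r s :: real where
      "\<forall>\<xi>\<in>gromov_closure. ext_gromov_product p \<xi> (Inr \<eta>) > ereal r \<longrightarrow> \<xi> \<in> S"
      "\<forall>\<xi>\<in>gromov_closure. ext_gromov_product p \<xi> (Inr \<eta>) > ereal s \<longrightarrow> \<xi> \<in> T"
      using S T unfolding gromov_open_def by blast
    moreover have "ereal r \<le> ereal (max r s)" "ereal s \<le> ereal (max r s)"
      by auto
    ultimately show "\<exists>r::real. \<forall>\<xi>\<in>gromov_closure.
        ext_gromov_product p \<xi> (Inr \<eta>) > ereal r \<longrightarrow> \<xi> \<in> S \<inter> T"
      by (meson IntI order_le_less_trans)
  qed
next
  fix K :: "'a gromov_point set set"
  assume K: "\<forall>U\<in>K. gromov_open U"
  show "gromov_open (\<Union>K)"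
    unfolding gromov_open_def
  proof (intro conjI allI impI)
    show "\<Union>K \<subseteq> gromov_closure" using K by (auto simp: gromov_open_def)
    show "open (Inl -` \<Union>K)"
      unfolding vimage_Union using K by (auto simp: gromov_open_def)
  next
    fix \<eta> p assume "Inr \<eta> \<in> \<Union>K"
    then obtain U where U: "U \<in> K" "Inr \<eta> \<in> U" by auto
    then obtain r :: real where
      "\<forall>\<xi>\<in>gromov_closure. ext_gromov_product p \<xi> (Inr \<eta>) > ereal r \<longrightarrow> \<xi> \<in> U"
      using K unfolding gromov_open_def by blast
    with U show "\<exists>r::real. \<forall>\<xi>\<in>gromov_closure.
        ext_gromov_product p \<xi> (Inr \<eta>) > ereal r \<longrightarrow> \<xi> \<in> \<Union>K"
      by blast
  qed
qed

lemma openin_gromov_topology: "openin gromov_topology U \<longleftrightarrow> gromov_open U"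
  by (simp add: gromov_topology_def istopology_gromov_open topology_inverse')

lemma topspace_gromov_topology:
  "topspace gromov_topology = (gromov_closure :: 'a::metric_space gromov_point set)"
proof -
  have "Inl -` (gromov_closure :: 'a gromov_point set) = UNIV"
    by (auto simp: gromov_closure_def)
  then have "gromov_open (gromov_closure :: 'a gromov_point set)"
    by (simp add: gromov_open_def)
  then show ?thesis
    unfolding topspace_def openin_gromov_topology by (auto simp: gromov_open_def)
qed

abbreviation gromov_converges :: "(nat \<Rightarrow> 'a::metric_space) \<Rightarrow> 'a gromov_point \<Rightarrow> bool" where
  "gromov_converges x \<xi> \<equiv> limitin gromov_topology (\<lambda>n. Inl (x n)) \<xi> sequentially"


section \<open>Boundary regular fixed points\<close>

definition geodesic_region :: "(real \<Rightarrow> 'a::metric_space) \<Rightarrow> real \<Rightarrow> 'a set" where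
  "geodesic_region \<gamma> R = {x. infdist x (\<gamma> ` {0..}) < R}"

definition has_geodesic_limit ::
  "('a::metric_space \<Rightarrow> 'a) \<Rightarrow> 'a gromov_point \<Rightarrow> (real \<Rightarrow> 'a) set \<Rightarrow> bool" where
  "has_geodesic_limit g \<xi> \<eta> \<longleftrightarrow>
     (\<forall>x. (\<exists>\<gamma>\<in>\<eta>. \<exists>R>0. \<forall>n. x n \<in> geodesic_region \<gamma> R) \<longrightarrow> gromov_converges x (Inr \<eta>) \<longrightarrow>
        gromov_converges (\<lambda>n. g (x n)) \<xi>)"

text \<open>The filter is the trace on \<open>X\<close> of the neighbourhood filter of \<open>\<eta>\<close>.\<close>

definition log_dilation ::
  "'a::metric_space \<Rightarrow> (real \<Rightarrow> 'a) set \<Rightarrow> ('a \<Rightarrow> 'a) \<Rightarrow> ereal" where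
  "log_dilation p \<eta> g =
     Liminf (filtercomap Inl (nhdsin gromov_topology (Inr \<eta>))) (\<lambda>z. ereal (dist z p - dist (g z) p))"

definition boundary_regular_fixed_point ::
  "('a::metric_space \<Rightarrow> 'a) \<Rightarrow> (real \<Rightarrow> 'a) set \<Rightarrow> bool" where
  "boundary_regular_fixed_point g \<eta> \<longleftrightarrow> \<eta> \<in> gromov_boundary \<and>
     (\<forall>p. log_dilation p \<eta> g < \<infinity>) \<and> has_geodesic_limit g (Inr \<eta>) \<eta>"

text \<open>For a non-expanding \<open>f\<close> with boundary regular fixed point \<open>\<eta>\<close> the limit exists, is finite
  and does not depend on \<open>p\<close>.\<close>

definition stable_dilation ::
  "'a::metric_space \<Rightarrow> (real \<Rightarrow> 'a) set \<Rightarrow> ('a \<Rightarrow> 'a) \<Rightarrow> real" where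
  "stable_dilation p \<eta> f =
     exp (real_of_ereal (lim (\<lambda>n. log_dilation p \<eta> (f ^^ n) / ereal (real n))))"


section \<open>Backward orbits\<close>

definition backward_orbit :: "('a \<Rightarrow> 'a) \<Rightarrow> (nat \<Rightarrow> 'a) \<Rightarrow> bool" where
  "backward_orbit f x \<longleftrightarrow> (\<forall>n. f (x (Suc n)) = x n)"

definition bounded_step :: "(nat \<Rightarrow> 'a::metric_space) \<Rightarrow> bool" where
  "bounded_step x \<longleftrightarrow> bdd_above (range (\<lambda>n. dist (x n) (x (Suc n))))"

definition backward_step :: "(nat \<Rightarrow> 'a::metric_space) \<Rightarrow> nat \<Rightarrow> real" where
  "backward_step x m = lim (\<lambda>n. dist (x n) (x (n + m)))"

definition backward_step_rate :: "(nat \<Rightarrow> 'a::metric_space) \<Rightarrow> real" where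
  "backward_step_rate x = lim (\<lambda>m. backward_step x m / real m)"

end

theory Submission
  imports Defs
begin

text \<open>Let \<open>\<gamma>\<close> be a ray representing \<open>\<eta>\<close>, let \<open>L n\<close> be the logarithm of the dilation of \<open>f\<^sup>n\<close> at \<open>\<eta>\<close>
  based at \<open>\<gamma> 0\<close>, and write \<open>h z\<close> for the distance of \<open>z\<close> to \<open>\<gamma> 0\<close>. The four point inequality
  shows that \<open>h (\<gamma> t) - h (f\<^sup>n (\<gamma> t))\<close> is at most \<open>L n\<close> up to a constant \<open>C\<close> independent of \<open>n\<close> and
  \<open>t\<close>. It follows that \<open>f\<^sup>n\<close> moves \<open>\<gamma> t\<close> by at most \<open>\<bar>L n\<bar> + C\<close> for large \<open>t\<close>, and that
  \<open>L\<close> is superadditive up to a constant, so that \<open>L n / n\<close> converges to the logarithm of the stable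
  dilation.

  Fix \<open>m\<close> with \<open>L m\<close> large compared with \<open>\<delta>\<close>. Near \<open>\<eta>\<close> each application of \<open>f\<^sup>m\<close> decreases \<open>h\<close>
  by almost \<open>L m\<close>, while it moves the points of the orbit of \<open>\<gamma> t\<close> by at most \<open>L m + C\<close>. So this
  orbit stays within bounded distance of \<open>\<gamma>\<close> until it reaches a fixed ball. Re-indexing the orbits
  backwards from their arrival times and letting \<open>t\<close> tend to infinity, a diagonal limit is a
  backward orbit \<open>x\<close> that stays close to \<open>\<gamma>\<close> and tends to \<open>\<eta>\<close>. Finally
  \<open>L q \<le> \<sigma>\<^sub>q(x) \<le> \<bar>L q\<bar> + C\<close>: the lower bound is the definition of the dilation as a lower limit
  at \<open>\<eta>\<close>, the upper bound comes from the displacement of the starting points \<open>\<gamma> t\<close>.\<close>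

section \<open>Hyperbolicity through the Gromov product\<close>

lemma gromov_product_commute: "gromov_product p x y = gromov_product p y x"
  by (simp add: gromov_product_def dist_commute)

lemma gromov_product_lipschitz: "\<bar>gromov_product p x z - gromov_product p y z\<bar> \<le> dist x y"
proof -
  have "\<bar>dist x p - dist y p\<bar> \<le> dist x y" "\<bar>dist x z - dist y z\<bar> \<le> dist x y"
    using abs_dist_diff_le[of x p y] abs_dist_diff_le[of x z y] by (simp_all add: dist_commute)
  then show ?thesis unfolding gromov_product_def by argo
qed

lemma gromov_product_basepoint: "\<bar>gromov_product p x y - gromov_product q x y\<bar> \<le> dist p q"
proof -
  have "\<bar>dist x p - dist x q\<bar> \<le> dist p q" "\<bar>dist y p - dist y q\<bar> \<le> dist p q"
    using abs_dist_diff_le[of p x q] abs_dist_diff_le[of p y q] by (simp_all add: dist_commute)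
  then show ?thesis unfolding gromov_product_def by argo
qed

lemma geodesic_segment_dist:
  assumes "geodesic_segment x y S" "w \<in> S"
  shows "dist x w + dist w y = dist x y"
proof -
  obtain g where g: "g 0 = x" "g (dist x y) = y"
    and iso: "\<And>s t. s \<in> {0..dist x y} \<Longrightarrow> t \<in> {0..dist x y} \<Longrightarrow> dist (g s) (g t) = \<bar>s - t\<bar>"
    and S: "S = g ` {0..dist x y}"
    using assms(1) unfolding geodesic_segment_def by blast
  from assms(2) S obtain t where t: "t \<in> {0..dist x y}" "w = g t" by auto
  then have "dist (g 0) w = t" "dist w (g (dist x y)) = dist x y - t"
    using iso[of 0 t] iso[of t "dist x y"] by auto
  with g show ?thesis by simp
qed

lemma geodesic_segment_connected:
  assumes "geodesic_segment x y S"
  shows "connected S" "x \<in> S" "y \<in> S"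
proof -
  obtain g where g: "g 0 = x" "g (dist x y) = y"
    and iso: "\<And>s t. s \<in> {0..dist x y} \<Longrightarrow> t \<in> {0..dist x y} \<Longrightarrow> dist (g s) (g t) = \<bar>s - t\<bar>"
    and S: "S = g ` {0..dist x y}"
    using assms(1) unfolding geodesic_segment_def by blast
  have "continuous_on {0..dist x y} g"
    unfolding continuous_on_iff by (metis iso dist_real_def dist_commute)
  then show "connected S" unfolding S by (intro connected_continuous_image) auto
  show "x \<in> S" "y \<in> S" unfolding S using g by (auto intro: image_eqI[of _ _ 0] image_eqI[of _ _ "dist x y"])
qed

lemma open_metric_nbhd: "open (metric_nbhd r S)"
proof -
  have "metric_nbhd r S = (\<Union>y\<in>S. ball y r)"
    by (auto simp: metric_nbhd_def dist_commute)
  then show ?thesis by auto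
qed

lemma metric_nbhd_Un: "metric_nbhd r (S \<union> T) = metric_nbhd r S \<union> metric_nbhd r T"
  by (auto simp: metric_nbhd_def)

lemma metric_nbhd_self: "0 < r \<Longrightarrow> x \<in> S \<Longrightarrow> x \<in> metric_nbhd r S"
  by (force simp: metric_nbhd_def)

lemma gromov_product_le_dist:
  assumes "geodesic_segment x y S" "w \<in> S"
  shows "gromov_product p x y \<le> dist p w"
proof -
  have "dist x p \<le> dist x w + dist p w" "dist y p \<le> dist w y + dist p w"
    by (metis dist_triangle2 dist_commute)+
  then show ?thesis
    using geodesic_segment_dist[OF assms] by (simp add: gromov_product_def)
qed

text \<open>\<open>S\<close> is connected, and the open \<delta>-neighbourhoods of the other two
  sides cover it and each contain an endpoint of it. Hence some \<open>w\<close> is close to both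
  sides issuing from \<open>p\<close>, and the length relations along these sides bound
  \<open>dist p w\<close>.\<close>

lemma dist_le_gromov_product:
  fixes x y p :: "'a::metric_space"
  assumes "geodesic_space TYPE('a)" "delta_hyperbolic TYPE('a) \<delta>" "\<delta> > 0"
    and S: "geodesic_segment x y S"
  shows "\<exists>w\<in>S. dist p w \<le> gromov_product p x y + 2 * \<delta>"
proof -
  obtain T U where T: "geodesic_segment y p T" and U: "geodesic_segment p x U"
    using assms(1) unfolding geodesic_space_def by blast
  have sub: "S \<subseteq> metric_nbhd \<delta> T \<union> metric_nbhd \<delta> U"
    using assms(2) S T U unfolding delta_hyperbolic_def metric_nbhd_Un by blast
  have "x \<in> metric_nbhd \<delta> U \<inter> S" "y \<in> metric_nbhd \<delta> T \<inter> S"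
    using geodesic_segment_connected(2,3)[OF S] geodesic_segment_connected(2)[OF T]
      geodesic_segment_connected(3)[OF U] metric_nbhd_self[OF \<open>\<delta> > 0\<close>] by auto
  then obtain w where w: "w \<in> S" "w \<in> metric_nbhd \<delta> T" "w \<in> metric_nbhd \<delta> U"
    using connectedD[OF geodesic_segment_connected(1)[OF S] open_metric_nbhd open_metric_nbhd _ sub]
    by blast
  then obtain u v where u: "u \<in> U" "dist w u < \<delta>" and v: "v \<in> T" "dist w v < \<delta>"
    unfolding metric_nbhd_def by blast
  have "dist p w \<le> dist p u + dist w u" "dist w x \<le> dist w u + dist u x"
    "dist p w \<le> dist v p + dist w v" "dist y w \<le> dist w v + dist y v"
    by (metis dist_triangle dist_commute)+
  then have "2 * dist p w \<le> 2 * gromov_product p x y + 4 * \<delta>"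
    using geodesic_segment_dist[OF S \<open>w \<in> S\<close>] geodesic_segment_dist[OF U u(1)]
      geodesic_segment_dist[OF T v(1)] u(2) v(2)
    unfolding gromov_product_def by (simp add: dist_commute field_simps)
  then have "dist p w \<le> gromov_product p x y + 2 * \<delta>" by linarith
  then show ?thesis using \<open>w \<in> S\<close> by blast
qed

text \<open>The distance from \<open>p\<close> to a geodesic lies between the product of its ends
  and that product plus 2\<delta>. A point of \<open>U\<close> realising the upper bound is within
  \<delta> of \<open>S\<close> or \<open>T\<close>, which makes the total loss 3\<delta>.\<close>

lemma four_point_inequality:
  fixes p x y z :: "'a::metric_space"
  assumes "geodesic_space TYPE('a)" "delta_hyperbolic TYPE('a) \<delta>" "\<delta> > 0"
  shows "min (gromov_product p x y) (gromov_product p y z) - 3 * \<delta> \<le> gromov_product p x z"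
proof -
  obtain S T U where S: "geodesic_segment x y S" and T: "geodesic_segment y z T"
    and U: "geodesic_segment z x U"
    using assms(1) unfolding geodesic_space_def by blast
  obtain w where w: "w \<in> U" "dist p w \<le> gromov_product p x z + 2 * \<delta>"
    using dist_le_gromov_product[OF assms U, of p] by (auto simp: gromov_product_commute)
  have "U \<subseteq> metric_nbhd \<delta> (S \<union> T)"
    using assms(2) S T U unfolding delta_hyperbolic_def by blast
  then obtain v where v: "v \<in> S \<union> T" "dist w v < \<delta>"
    using w unfolding metric_nbhd_def by blast
  have "min (gromov_product p x y) (gromov_product p y z) \<le> dist p v"
    using v(1) gromov_product_le_dist[OF S] gromov_product_le_dist[OF T] by (meson UnE min.coboundedI1 min.coboundedI2)
  also have "\<dots> \<le> dist p w + dist w v" by (rule dist_triangle)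
  finally show ?thesis using w(2) v(2) by linarith
qed

section \<open>Geodesic rays in a boundary class\<close>

lemma geodesic_ray_dist:
  "\<gamma> \<in> geodesic_rays \<Longrightarrow> s \<ge> 0 \<Longrightarrow> t \<ge> 0 \<Longrightarrow> dist (\<gamma> s) (\<gamma> t) = \<bar>s - t\<bar>"
  by (simp add: geodesic_rays_def)

lemma gromov_boundary_ray: "\<zeta> \<in> gromov_boundary \<Longrightarrow> \<alpha> \<in> \<zeta> \<Longrightarrow> \<alpha> \<in> geodesic_rays"
  unfolding gromov_boundary_def
  using in_quotient_imp_subset[OF equiv_asymptotic_rel] by blast

lemma gromov_boundary_asymptotic:
  assumes "\<zeta> \<in> gromov_boundary" "\<alpha> \<in> \<zeta>" "\<beta> \<in> \<zeta>"
  obtains C where "\<And>t. t \<ge> 0 \<Longrightarrow> dist (\<alpha> t) (\<beta> t) \<le> C"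
  using quotient_eq_iff[OF equiv_asymptotic_rel, of \<zeta> \<zeta> \<alpha> \<beta>] assms
  unfolding gromov_boundary_def asymptotic_rel_def by blast

lemma gromov_boundary_nonempty: "\<zeta> \<in> gromov_boundary \<Longrightarrow> \<exists>\<alpha>. \<alpha> \<in> \<zeta>"
  unfolding gromov_boundary_def
  using in_quotient_imp_non_empty[OF equiv_asymptotic_rel] by blast

section \<open>Neighbourhoods of boundary points\<close>

text \<open>A lower bound for the product of \<open>x\<close> with the end of \<alpha>. Tied to one
  fixed ray, it avoids the supremum over representatives in
  \<open>ext_gromov_product\<close>.\<close>

definition near_boundary :: "'a::metric_space \<Rightarrow> real \<Rightarrow> 'a \<Rightarrow> (real \<Rightarrow> 'a) \<Rightarrow> bool" where
  "near_boundary p r x \<alpha> \<longleftrightarrow> (\<forall>\<^sub>F s in at_top. r < gromov_product p x (\<alpha> s))"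

lemma near_boundary_mono: "near_boundary p r x \<alpha> \<Longrightarrow> r' \<le> r \<Longrightarrow> near_boundary p r' x \<alpha>"
  unfolding near_boundary_def by (erule eventually_mono) simp

lemma near_boundary_lipschitz:
  assumes "near_boundary p r x \<alpha>"
  shows "near_boundary p (r - dist x y) y \<alpha>"
  using assms gromov_product_lipschitz[of p x _ y] unfolding near_boundary_def
  by (elim eventually_mono) (metis abs_le_D1 diff_less_eq less_le_trans add.commute diff_le_eq)

lemma near_boundary_basepoint:
  assumes "near_boundary p r x \<alpha>"
  shows "near_boundary q (r - dist p q) x \<alpha>"
  using assms gromov_product_basepoint[of p x _ q] unfolding near_boundary_def
  by (elim eventually_mono) (metis abs_le_D1 diff_less_eq less_le_trans add.commute diff_le_eq)

section \<open>Comparison with the extended Gromov product\<close>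

lemma eventually_principal_prod:
  "eventually P (principal {x} \<times>\<^sub>F G) \<longleftrightarrow> (\<forall>\<^sub>F y in G. P (x, y))"
proof
  assume "eventually P (principal {x} \<times>\<^sub>F G)"
  from eventually_eventually_prod_filter1[OF this] show "\<forall>\<^sub>F y in G. P (x, y)"
    by (simp add: eventually_principal)
next
  assume "\<forall>\<^sub>F y in G. P (x, y)"
  then show "eventually P (principal {x} \<times>\<^sub>F G)"
    unfolding eventually_prod_filter
    by (intro exI[of _ "\<lambda>y. y = x"] exI[of _ "\<lambda>y. P (x, y)"]) (auto simp: eventually_principal)
qed

lemma ext_gromov_product_less:
  assumes "ext_gromov_product p (Inl x) (Inr \<zeta>) > ereal r"
  shows "\<exists>\<alpha>\<in>\<zeta>. near_boundary p r x \<alpha>"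
proof -
  obtain \<alpha> where \<alpha>: "\<alpha> \<in> \<zeta>"
    "ereal r < Liminf (principal {x} \<times>\<^sub>F filtermap \<alpha> at_top) (\<lambda>(x, y). ereal (gromov_product p x y))"
    using assms unfolding ext_gromov_product_def approaches_def by (auto simp: less_SUP_iff)
  from less_LiminfD[OF \<alpha>(2)] have "near_boundary p r x \<alpha>"
    unfolding near_boundary_def eventually_principal_prod eventually_filtermap by simp
  with \<alpha> show ?thesis by blast
qed

lemma ext_gromov_product_ge:
  assumes "\<alpha> \<in> \<zeta>" "near_boundary p r x \<alpha>"
  shows "ext_gromov_product p (Inl x) (Inr \<zeta>) \<ge> ereal r"
proof -
  have "ereal r \<le> Liminf (principal {x} \<times>\<^sub>F filtermap \<alpha> at_top)
      (\<lambda>(x, y). ereal (gromov_product p x y))"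
    by (rule Liminf_bounded, use assms(2) in \<open>unfold near_boundary_def eventually_principal_prod
      eventually_filtermap, elim eventually_mono\<close>) auto
  also have "\<dots> \<le> ext_gromov_product p (Inl x) (Inr \<zeta>)"
    unfolding ext_gromov_product_def approaches_def
    using assms(1) by (auto intro!: SUP_upper)
  finally show ?thesis .
qed

text \<open>The product filter is weakened to iterated limits in an order suited to comparing rays:
  for each fixed late point of \<alpha>, late points of \<alpha>' may be chosen.\<close>

lemma ext_gromov_product_boundary_less:
  assumes "ext_gromov_product p (Inr \<zeta>') (Inr \<zeta>) > ereal r"
  shows "\<exists>\<alpha>'\<in>\<zeta>'. \<exists>\<alpha>\<in>\<zeta>. \<forall>\<^sub>F s in at_top. \<forall>\<^sub>F s' in at_top. r < gromov_product p (\<alpha>' s') (\<alpha> s)"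
proof -
  obtain \<alpha>' \<alpha> where \<alpha>: "\<alpha>' \<in> \<zeta>'" "\<alpha> \<in> \<zeta>"
    "ereal r < Liminf (filtermap \<alpha>' at_top \<times>\<^sub>F filtermap \<alpha> at_top)
       (\<lambda>(x, y). ereal (gromov_product p x y))"
    using assms unfolding ext_gromov_product_def approaches_def by (auto simp: less_SUP_iff)
  from eventually_eventually_prod_filter2[OF less_LiminfD[OF \<alpha>(3)]]
  have "\<forall>\<^sub>F s in at_top. \<forall>\<^sub>F s' in at_top. r < gromov_product p (\<alpha>' s') (\<alpha> s)"
    unfolding eventually_filtermap by simp
  with \<alpha> show ?thesis by blast
qed

text \<open>From here on \<delta> is the constant of the four point inequality, three times the
  constant of thin triangles when the locale is instantiated.\<close>

locale hyperbolic_space =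
  fixes X :: "'a::metric_space itself" and \<delta> :: real
  assumes four_point: "\<And>p x y z :: 'a.
      min (gromov_product p x y) (gromov_product p y z) - \<delta> \<le> gromov_product p x z"
    and delta_pos: "\<delta> > 0"
begin

lemma near_boundary_transfer:
  fixes x :: 'a
  assumes "near_boundary p r x \<alpha>"
    and "\<forall>\<^sub>F s in at_top. \<forall>\<^sub>F s' in at_top. r < gromov_product p (\<alpha> s') (\<beta> s)"
  shows "near_boundary p (r - \<delta>) x \<beta>"
  unfolding near_boundary_def using assms(2)
proof eventually_elim
  case (elim s)
  with assms(1) have "\<forall>\<^sub>F s' in at_top. r < gromov_product p x (\<alpha> s') \<and> r < gromov_product p (\<alpha> s') (\<beta> s)"
    unfolding near_boundary_def by (rule eventually_conj)
  then obtain s' where "r < gromov_product p x (\<alpha> s')" "r < gromov_product p (\<alpha> s') (\<beta> s)"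
    by (auto dest: eventually_happens'[OF trivial_limit_at_top_linorder])
  then show ?case using four_point[of p x "\<alpha> s'" "\<beta> s"] by linarith
qed

text \<open>Distances to \<open>p\<close> grow like the parameters, while
  \<open>dist (\<alpha> s') (\<beta> s)\<close> is at most \<open>s' - s + C\<close>; the product is
  therefore at least \<open>s\<close> up to a constant.\<close>

lemma asymptotic_gromov_product:
  fixes p :: 'a
  assumes "\<zeta> \<in> gromov_boundary" "\<alpha> \<in> \<zeta>" "\<beta> \<in> \<zeta>"
  shows "\<forall>\<^sub>F s in at_top. \<forall>\<^sub>F s' in at_top. r < gromov_product p (\<alpha> s') (\<beta> s)"
proof -
  obtain C where C: "\<And>t. t \<ge> 0 \<Longrightarrow> dist (\<alpha> t) (\<beta> t) \<le> C"
    using gromov_boundary_asymptotic[OF assms] by blast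
  note ray = gromov_boundary_ray[OF assms(1,2)]
  have "r < gromov_product p (\<alpha> s') (\<beta> s)"
    if s: "s > max 0 (r + C + dist (\<alpha> 0) p)" "s' > s" for s s'
  proof -
    have "dist (\<alpha> s') p \<ge> s' - dist (\<alpha> 0) p" "dist (\<alpha> s) p \<ge> s - dist (\<alpha> 0) p"
      using geodesic_ray_dist[OF ray, of 0 s'] geodesic_ray_dist[OF ray, of 0 s] s
        dist_triangle2[of "\<alpha> 0" "\<alpha> s" p] dist_triangle2[of "\<alpha> 0" "\<alpha> s'" p] by auto
    moreover have "dist (\<alpha> s) (\<beta> s) \<le> C" using C s by auto
    moreover have "dist (\<beta> s) p \<ge> dist (\<alpha> s) p - dist (\<alpha> s) (\<beta> s)"
      using dist_triangle[of "\<alpha> s" p "\<beta> s"] by linarith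
    moreover have "dist (\<alpha> s') (\<beta> s) \<le> s' - s + dist (\<alpha> s) (\<beta> s)"
      using dist_triangle[of "\<alpha> s'" "\<beta> s" "\<alpha> s"] geodesic_ray_dist[OF ray, of s' s] s by auto
    ultimately show ?thesis using s unfolding gromov_product_def by argo
  qed
  then show ?thesis
    by (intro eventually_mono[OF eventually_gt_at_top[of "max 0 (r + C + dist (\<alpha> 0) p)"]]
        eventually_mono[OF eventually_gt_at_top]) blast
qed

lemma near_boundary_asymptotic:
  fixes x :: 'a
  assumes "\<zeta> \<in> gromov_boundary" "\<alpha> \<in> \<zeta>" "\<beta> \<in> \<zeta>" "near_boundary p r x \<alpha>"
  shows "near_boundary p (r - \<delta>) x \<beta>"
  using near_boundary_transfer[OF assms(4) asymptotic_gromov_product[OF assms(1-3)]] .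

text \<open>The supremum in the extended product yields some unspecified ray of \<zeta>; replacing
  it by the given \<alpha> costs \<delta>.\<close>

lemma near_boundary_ext:
  fixes x :: 'a
  assumes "\<zeta> \<in> gromov_boundary" "\<alpha> \<in> \<zeta>" "ext_gromov_product p (Inl x) (Inr \<zeta>) > ereal r"
  shows "near_boundary p (r - \<delta>) x \<alpha>"
  using ext_gromov_product_less[OF assms(3)] near_boundary_asymptotic assms(1,2) by blast

text \<open>Adding all boundary points that are separated from the complement of a given open set
  produces an open set of the compactification; the four point inequality is what makes the
  boundary part open.\<close>

lemma gromov_open_boundary_extension:
  fixes A :: "'a set" and q :: 'a
  assumes "open A"
  defines "B \<equiv> {\<zeta> \<in> gromov_boundary.
      \<exists>r::real. \<forall>x. ext_gromov_product q (Inl x) (Inr \<zeta>) > ereal r \<longrightarrow> x \<in> A}"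
  shows "gromov_open (Inl ` A \<union> Inr ` B)"
  unfolding gromov_open_def
proof (intro conjI allI impI)
  show "Inl ` A \<union> Inr ` B \<subseteq> gromov_closure" by (auto simp: gromov_closure_def B_def)
  have "Inl -` (Inl ` A \<union> Inr ` B) = A" by auto
  then show "open (Inl -` (Inl ` A \<union> Inr ` B))" using assms(1) by simp
next
  fix \<zeta> p assume "Inr \<zeta> \<in> (Inl ` A \<union> Inr ` B :: 'a gromov_point set)"
  then have \<zeta>: "\<zeta> \<in> gromov_boundary" and "\<exists>r::real. \<forall>x. ext_gromov_product q (Inl x) (Inr \<zeta>) > ereal r \<longrightarrow> x \<in> A"
    by (auto simp: B_def)
  then obtain r :: real where r: "\<And>x. ext_gromov_product q (Inl x) (Inr \<zeta>) > ereal r \<Longrightarrow> x \<in> A"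
    by blast
  \<comment> \<open>The extra 1 restores the strict inequality, as
    \<open>ext_gromov_product_ge\<close> is not strict.\<close>
  have inA: "x \<in> A" if "\<alpha> \<in> \<zeta>" "near_boundary q (r + 1) x \<alpha>" for x \<alpha>
    using r[of x] ext_gromov_product_ge[OF that] less_le_trans[of "ereal r" "ereal (r + 1)"] by simp
  \<comment> \<open>Leaves room for moving the base point from \<open>p\<close> to \<open>q\<close>
    and for passing from a ray of \<zeta>' to a ray of \<zeta>.\<close>
  define d where "d = r + 1 + dist p q + 2 * \<delta>"
  have "\<xi> \<in> Inl ` A \<union> Inr ` B"
    if \<xi>: "\<xi> \<in> gromov_closure" "ext_gromov_product p \<xi> (Inr \<zeta>) > ereal d" for \<xi>
  proof (cases \<xi>)
    case (Inl x)
    with \<xi>(2) obtain \<alpha> where "\<alpha> \<in> \<zeta>" "near_boundary p d x \<alpha>"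
      using ext_gromov_product_less by blast
    then have "x \<in> A"
      using near_boundary_mono[OF near_boundary_basepoint[of p d x \<alpha> q], of "r + 1"] inA delta_pos
      by (auto simp: d_def)
    then show ?thesis using Inl by simp
  next
    case (Inr \<zeta>')
    then have \<zeta>': "\<zeta>' \<in> gromov_boundary" using \<xi>(1) by (auto simp: gromov_closure_def)
    from \<xi>(2) Inr obtain \<alpha>' \<alpha> where \<alpha>: "\<alpha>' \<in> \<zeta>'" "\<alpha> \<in> \<zeta>"
      "\<forall>\<^sub>F s in at_top. \<forall>\<^sub>F s' in at_top. d < gromov_product p (\<alpha>' s') (\<alpha> s)"
      using ext_gromov_product_boundary_less by blast
    \<comment> \<open>This threshold witnesses membership of \<zeta>' in \<open>B\<close>: \<delta>
      is lost on passing to the ray \<alpha>', and \<open>dist p q\<close> on returning to the base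
      point \<open>p\<close>.\<close>
    have "x \<in> A" if x: "ext_gromov_product q (Inl x) (Inr \<zeta>') > ereal (d + dist p q + \<delta>)" for x
    proof -
      have "near_boundary q (d + dist p q) x \<alpha>'"
        using near_boundary_ext[OF \<zeta>' \<alpha>(1) x] by simp
      from near_boundary_basepoint[OF this, of p] have "near_boundary p d x \<alpha>'"
        by (simp add: dist_commute)
      from near_boundary_basepoint[OF near_boundary_transfer[OF this \<alpha>(3)], of q]
      have "near_boundary q (d - \<delta> - dist p q) x \<alpha>" .
      then have "near_boundary q (r + 1) x \<alpha>"
        by (rule near_boundary_mono) (use delta_pos in \<open>simp add: d_def\<close>)
      with inA \<alpha>(2) show ?thesis by blast
    qed
    with \<zeta>' have "\<zeta>' \<in> B" unfolding B_def by blast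
    then show ?thesis using Inr by simp
  qed
  then show "\<exists>r::real. \<forall>\<xi>\<in>gromov_closure. ext_gromov_product p \<xi> (Inr \<zeta>) > ereal r \<longrightarrow> \<xi> \<in> Inl ` A \<union> Inr ` B"
    by blast
qed

end

section \<open>The neighbourhood filter of a boundary point, seen along a ray\<close>

locale hyperbolic_ray = hyperbolic_space X \<delta> for X :: "'a::metric_space itself" and \<delta> +
  fixes \<gamma> :: "real \<Rightarrow> 'a" and \<eta> :: "(real \<Rightarrow> 'a) set"
  assumes boundary: "\<eta> \<in> gromov_boundary" and ray_mem: "\<gamma> \<in> \<eta>"
begin

abbreviation pt where "pt \<equiv> \<gamma> 0"

definition boundary_filter :: "'a filter" where
  "boundary_filter = filtercomap Inl (nhdsin gromov_topology (Inr \<eta>))"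

lemma ray_dist: "s \<ge> 0 \<Longrightarrow> t \<ge> 0 \<Longrightarrow> dist (\<gamma> s) (\<gamma> t) = \<bar>s - t\<bar>"
  using geodesic_ray_dist gromov_boundary_ray[OF boundary ray_mem] by blast

lemma ray_product: "0 \<le> t \<Longrightarrow> t \<le> s \<Longrightarrow> gromov_product pt (\<gamma> t) (\<gamma> s) = t"
  by (simp add: gromov_product_def ray_dist)

lemma Inr_in_topspace: "Inr \<eta> \<in> topspace gromov_topology"
  using boundary by (simp add: topspace_gromov_topology gromov_closure_def)

lemma eventually_boundary_filter:
  "eventually P boundary_filter \<longleftrightarrow> (\<exists>U. gromov_open U \<and> Inr \<eta> \<in> U \<and> (\<forall>x. Inl x \<in> U \<longrightarrow> P x))"
  unfolding boundary_filter_def eventually_filtercomap eventually_nhdsin openin_gromov_topology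
  using Inr_in_topspace by (simp, blast)

lemma near_ray_in_open:
  assumes "gromov_open U" "Inr \<eta> \<in> U"
  shows "\<exists>R\<ge>0. \<forall>x t. t \<ge> R \<longrightarrow> dist x (\<gamma> t) \<le> C \<longrightarrow> Inl x \<in> U"
proof -
  obtain r :: real where r: "\<And>\<xi>. \<xi> \<in> gromov_closure \<Longrightarrow> ext_gromov_product pt \<xi> (Inr \<eta>) > ereal r \<Longrightarrow> \<xi> \<in> U"
    using assms unfolding gromov_open_def by blast
  \<comment> \<open>Moving from \<open>\<gamma> t\<close> to \<open>x\<close> costs
    \<open>C\<close>; one unit makes the bound in \<open>near_boundary\<close> strict, the other
    makes the extended product exceed \<open>r\<close> strictly.\<close>
  have "Inl x \<in> U" if "t \<ge> max 0 (r + C + 2)" "dist x (\<gamma> t) \<le> C" for x t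
  proof (rule r)
    show "Inl x \<in> gromov_closure" by (simp add: gromov_closure_def)
    have "near_boundary pt (t - 1) (\<gamma> t) \<gamma>"
      unfolding near_boundary_def using eventually_ge_at_top[of t]
      by eventually_elim (use that in \<open>simp add: ray_product\<close>)
    from near_boundary_lipschitz[OF this, of x] have "near_boundary pt (r + 1) x \<gamma>"
      by (rule near_boundary_mono) (use that in \<open>simp add: dist_commute\<close>)
    from ext_gromov_product_ge[OF ray_mem this]
    show "ext_gromov_product pt (Inl x) (Inr \<eta>) > ereal r"
      by (rule less_le_trans[rotated]) simp
  qed
  then show ?thesis by (intro exI[of _ "max 0 (r + C + 2)"]) auto
qed

lemma eventually_near_ray:
  assumes "eventually P boundary_filter"
  shows "\<exists>R\<ge>0. \<forall>x t. t \<ge> R \<longrightarrow> dist x (\<gamma> t) \<le> C \<longrightarrow> P x"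
  using assms near_ray_in_open unfolding eventually_boundary_filter by metis

lemma gromov_converges_near_ray:
  assumes "filterlim t at_top sequentially" "\<And>n. dist (x n) (\<gamma> (t n)) \<le> C"
  shows "gromov_converges x (Inr \<eta>)"
  unfolding limitin_def openin_gromov_topology
proof (intro conjI allI impI Inr_in_topspace)
  fix U :: "'a gromov_point set" assume "gromov_open U \<and> Inr \<eta> \<in> U"
  then obtain R where "\<And>x t. t \<ge> R \<Longrightarrow> dist x (\<gamma> t) \<le> C \<Longrightarrow> Inl x \<in> U"
    using near_ray_in_open[of U C] by blast
  with assms show "\<forall>\<^sub>F n in sequentially. Inl (x n) \<in> U"
    unfolding filterlim_at_top by (metis (mono_tags, lifting) eventually_mono)
qed

lemma eventually_boundary_converges:
  "gromov_converges x (Inr \<eta>) \<Longrightarrow> eventually P boundary_filter \<Longrightarrow> \<forall>\<^sub>F n in sequentially. P (x n)"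
  unfolding eventually_boundary_filter limitin_def openin_gromov_topology
  by (metis (mono_tags, lifting) eventually_mono)

text \<open>Conversely to \<open>near_ray_in_open\<close>, closeness in the topology gives a large
  product with the fixed ray. This requires an honest open set of the compactification inside the
  product condition, built by \<open>gromov_open_boundary_extension\<close>.\<close>

lemma eventually_near_boundary: "\<forall>\<^sub>F x in boundary_filter. near_boundary pt r x \<gamma>"
proof -
  \<comment> \<open>The margin \<open>e\<close> makes the set open, since moving a point by less
    than \<open>e / 2\<close> uses up only half of it.\<close>
  define A where "A = {x. \<exists>e>0. near_boundary pt (r + e) x \<gamma>}"
  define B where "B = {\<zeta> \<in> gromov_boundary.
      \<exists>r::real. \<forall>x. ext_gromov_product pt (Inl x) (Inr \<zeta>) > ereal r \<longrightarrow> x \<in> A}"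
  have "open A"
    unfolding open_dist
  proof
    fix x assume "x \<in> A"
    then obtain e where e: "e > 0" "near_boundary pt (r + e) x \<gamma>" by (auto simp: A_def)
    have "y \<in> A" if "dist y x < e / 2" for y
      using near_boundary_mono[OF near_boundary_lipschitz[OF e(2), of y], of "r + e / 2"] that e(1)
      unfolding A_def by (auto simp: dist_commute intro!: exI[of _ "e / 2"])
    then show "\<exists>e>0. \<forall>y. dist y x < e \<longrightarrow> y \<in> A" using e(1) by (auto intro!: exI[of _ "e / 2"])
  qed
  then have "gromov_open (Inl ` A \<union> Inr ` B)"
    unfolding B_def by (rule gromov_open_boundary_extension)
  moreover have "x \<in> A" if "ext_gromov_product pt (Inl x) (Inr \<eta>) > ereal (r + 1 + \<delta>)" for x
    using near_boundary_ext[OF boundary ray_mem that] unfolding A_def by (auto intro!: exI[of _ 1])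
  then have "\<eta> \<in> B" using boundary unfolding B_def by blast
  moreover have "near_boundary pt r x \<gamma>" if "x \<in> A" for x
    using that near_boundary_mono unfolding A_def by fastforce
  ultimately show ?thesis unfolding eventually_boundary_filter
    by (intro exI[of _ "Inl ` A \<union> Inr ` B"]) auto
qed

end

section \<open>Dilation along a ray\<close>

lemma non_expandingD: "non_expanding f \<Longrightarrow> dist (f x) (f y) \<le> dist x y"
  by (simp add: non_expanding_def)

lemma non_expanding_funpow: "non_expanding f \<Longrightarrow> non_expanding (f ^^ n)"
proof (induction n)
  case (Suc n)
  then show ?case unfolding non_expanding_def by (metis comp_apply funpow.simps(2) order_trans)
qed (simp add: non_expanding_def)

context hyperbolic_ray
begin

definition descent :: "('a \<Rightarrow> 'a) \<Rightarrow> 'a \<Rightarrow> real" where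
  "descent g z = dist z pt - dist (g z) pt"

lemma log_dilation_eq: "log_dilation pt \<eta> g = Liminf boundary_filter (\<lambda>z. ereal (descent g z))"
  by (simp add: log_dilation_def boundary_filter_def descent_def)

lemma boundary_filter_neq_bot: "boundary_filter \<noteq> bot"
proof
  assume "boundary_filter = bot"
  then have "\<forall>\<^sub>F x in boundary_filter. False" by simp
  \<comment> \<open>Radius 0 restricts the statement to points of the ray itself.\<close>
  then obtain R where "R \<ge> 0" "\<And>x t. t \<ge> R \<Longrightarrow> dist x (\<gamma> t) \<le> 0 \<Longrightarrow> False"
    using eventually_near_ray[where C = 0] by blast
  from this(2)[of R "\<gamma> R"] show False by simp
qed

lemma eventually_descent_gt:
  assumes "log_dilation pt \<eta> g = ereal L" "c < L"
  shows "\<forall>\<^sub>F z in boundary_filter. c < descent g z"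
  using less_LiminfD[of "ereal c" boundary_filter "\<lambda>z. ereal (descent g z)"] assms
  by (simp add: log_dilation_eq)

lemma le_log_dilation:
  assumes "log_dilation pt \<eta> g = ereal L" "\<forall>\<^sub>F z in boundary_filter. c \<le> descent g z"
  shows "c \<le> L"
  using Liminf_bounded[of "ereal c" "\<lambda>z. ereal (descent g z)" boundary_filter] assms
  by (simp add: log_dilation_eq)

lemma log_dilation_finite:
  assumes "\<And>x. - c \<le> descent g x" and "\<And>t. t \<ge> 0 \<Longrightarrow> descent g (\<gamma> t) \<le> c'"
  shows "\<bar>log_dilation pt \<eta> g\<bar> \<noteq> \<infinity>"
proof -
  have "ereal (- c) \<le> log_dilation pt \<eta> g"
    unfolding log_dilation_eq by (rule Liminf_bounded) (use assms(1) in simp)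
  moreover have "log_dilation pt \<eta> g \<le> ereal c'"
  proof (rule ccontr)
    assume "\<not> ?thesis"
    then have "ereal c' < log_dilation pt \<eta> g" by simp
    from less_LiminfD[OF this[unfolded log_dilation_eq]]
    have "\<forall>\<^sub>F z in boundary_filter. c' < descent g z" by simp
    then obtain R where R: "R \<ge> 0" "\<And>x t. t \<ge> R \<Longrightarrow> dist x (\<gamma> t) \<le> 0 \<Longrightarrow> c' < descent g x"
      using eventually_near_ray[where C = 0] by blast
    from R(2)[of R "\<gamma> R"] assms(2)[OF R(1)] show False by simp
  qed
  ultimately show ?thesis by auto
qed

text \<open>The lower limit defining the dilation ranges over all approaches to the boundary point, but
  by hyperbolicity the ray itself realises it up to a constant depending on \<open>\<delta>\<close> only.\<close>

lemma descent_ray_le: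
  assumes g: "non_expanding g" and L: "log_dilation pt \<eta> g = ereal L" and "t \<ge> 0"
  shows "descent g (\<gamma> t) \<le> L + 2 * \<delta>"
proof (rule field_le_epsilon)
  fix e :: real assume "e > 0"
  then have "\<not> (\<forall>\<^sub>F z in boundary_filter. L + e \<le> descent g z)"
    using le_log_dilation[OF L, of "L + e"] by auto
  then have "\<exists>\<^sub>F z in boundary_filter. descent g z < L + e"
    by (simp add: frequently_def not_less)
  from frequently_eventually_frequently[OF this eventually_near_boundary[of t]]
  obtain z where z: "descent g z < L + e" "near_boundary pt t z \<gamma>"
    by (auto dest: frequently_ex)
  have "\<forall>\<^sub>F s in at_top. t < gromov_product pt z (\<gamma> s) \<and> t \<le> s"
    using z(2) eventually_ge_at_top unfolding near_boundary_def by (rule eventually_conj)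
  then obtain s where s: "t < gromov_product pt z (\<gamma> s)" "t \<le> s"
    by (auto dest: eventually_happens'[OF trivial_limit_at_top_linorder])
  \<comment> \<open>Thus \<open>\<gamma> t\<close> lies almost between \<open>pt\<close> and
    \<open>z\<close>: \<open>dist z (\<gamma> t)\<close> is at most
    \<open>dist z pt - t + 2 * \<delta>\<close>. Applying \<open>g\<close> then bounds the descent
    at \<open>\<gamma> t\<close> by that at \<open>z\<close> plus 2\<delta>.\<close>
  have "t - \<delta> \<le> gromov_product pt z (\<gamma> t)"
    using four_point[of pt z "\<gamma> s" "\<gamma> t"] s ray_product[of t s] \<open>t \<ge> 0\<close>
    by (simp add: gromov_product_commute min_def split: if_splits)
  moreover have "dist (\<gamma> t) pt = t" using ray_dist[of t 0] \<open>t \<ge> 0\<close> by simp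
  moreover have "dist (g z) pt \<le> dist (g (\<gamma> t)) pt + dist z (\<gamma> t)"
    using non_expandingD[OF g, of z "\<gamma> t"] dist_triangle[of "g z" pt "g (\<gamma> t)"] by linarith
  ultimately show "descent g (\<gamma> t) \<le> L + 2 * \<delta> + e"
    using z(1) unfolding descent_def gromov_product_def by argo
qed

text \<open>The images of \<open>\<gamma> t\<close> and \<open>\<gamma> s\<close> are at most
  \<open>s - t\<close> apart, and \<open>descent_ray_le\<close> keeps both far from
  \<open>pt\<close>, so their product is at least \<open>t - L - 2 * \<delta>\<close>. By
  \<open>esc\<close> the image of \<open>\<gamma> s\<close> may be taken near \<eta>, and the four
  point inequality costs the third \<delta>.\<close>

lemma image_ray_product:
  assumes g: "non_expanding g" and L: "log_dilation pt \<eta> g = ereal L" and "t \<ge> 0"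
    and esc: "\<And>r T. \<exists>s\<ge>T. near_boundary pt r (g (\<gamma> s)) \<gamma>"
  shows "\<forall>\<^sub>F s in at_top. t - L - 3 * \<delta> \<le> gromov_product pt (g (\<gamma> t)) (\<gamma> s)"
proof -
  obtain s where s: "s \<ge> t" "near_boundary pt (t - L - 2 * \<delta>) (g (\<gamma> s)) \<gamma>"
    using esc by blast
  have "dist (\<gamma> t) pt = t" "dist (\<gamma> s) pt = s" "dist (g (\<gamma> t)) (g (\<gamma> s)) \<le> s - t"
    using ray_dist[of t 0] ray_dist[of s 0] ray_dist[of t s] s(1) \<open>t \<ge> 0\<close>
      non_expandingD[OF g, of "\<gamma> t" "\<gamma> s"] by simp_all
  then have *: "t - L - 2 * \<delta> \<le> gromov_product pt (g (\<gamma> t)) (g (\<gamma> s))"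
    using descent_ray_le[OF g L, of t] descent_ray_le[OF g L, of s] s(1) \<open>t \<ge> 0\<close>
    unfolding descent_def gromov_product_def by argo
  show ?thesis
    using s(2) unfolding near_boundary_def
  proof eventually_elim
    case (elim s')
    then show ?case using * four_point[of pt "g (\<gamma> t)" "g (\<gamma> s)" "\<gamma> s'"] by linarith
  qed
qed

text \<open>The image of \<open>\<gamma> t\<close> is compared with \<open>\<gamma> t\<close>
  through a later ray point. As \<open>\<gamma> t\<close> has product only \<open>t\<close> with
  that point, a negative \<open>L\<close> brings no gain, whence \<open>max L 0\<close>.\<close>

lemma dist_image_ray_le:
  assumes g: "non_expanding g" and L: "log_dilation pt \<eta> g = ereal L" and "t \<ge> 0"
    and esc: "\<And>r T. \<exists>s\<ge>T. near_boundary pt r (g (\<gamma> s)) \<gamma>"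
  shows "dist (g (\<gamma> t)) (\<gamma> t) \<le> 2 * max L 0 - descent g (\<gamma> t) + 8 * \<delta>"
proof -
  have "\<forall>\<^sub>F s in at_top. t - L - 3 * \<delta> \<le> gromov_product pt (g (\<gamma> t)) (\<gamma> s) \<and> t \<le> s"
    using image_ray_product[OF g L \<open>t \<ge> 0\<close> esc] eventually_ge_at_top by (rule eventually_conj)
  then obtain s where s: "t - L - 3 * \<delta> \<le> gromov_product pt (g (\<gamma> t)) (\<gamma> s)" "t \<le> s"
    by (auto dest: eventually_happens'[OF trivial_limit_at_top_linorder])
  have "min (t - L - 3 * \<delta>) t - \<delta> \<le> gromov_product pt (g (\<gamma> t)) (\<gamma> t)"
    using four_point[of pt "g (\<gamma> t)" "\<gamma> s" "\<gamma> t"] s ray_product[of t s] \<open>t \<ge> 0\<close>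
    by (simp add: gromov_product_commute min_def split: if_splits)
  moreover have "dist (\<gamma> t) pt = t" using ray_dist[of t 0] \<open>t \<ge> 0\<close> by simp
  ultimately show ?thesis
    using delta_pos unfolding descent_def gromov_product_def by (simp add: max_def min_def split: if_splits)
qed

lemma log_dilation_basepoint:
  fixes p q :: 'a
  assumes "c = - 2 * dist p q"
  shows "log_dilation p \<eta> g + ereal c \<le> log_dilation q \<eta> g"
proof -
  have "log_dilation p \<eta> g + ereal c =
      Liminf (filtercomap Inl (nhdsin gromov_topology (Inr \<eta>))) (\<lambda>z. ereal (dist z p - dist (g z) p) + ereal c)"
    unfolding log_dilation_def
    by (rule Liminf_add_ereal_right[OF boundary_filter_neq_bot[unfolded boundary_filter_def], symmetric]) simp
  also have "\<dots> \<le> log_dilation q \<eta> g"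
    unfolding log_dilation_def
  proof (rule Liminf_mono, rule always_eventually, rule allI)
    fix z
    show "ereal (dist z p - dist (g z) p) + ereal c \<le> ereal (dist z q - dist (g z) q)"
      using dist_triangle[of z p q] dist_triangle[of "g z" q p] assms by (simp add: dist_commute)
  qed
  finally show ?thesis .
qed

end

section \<open>Iterates at a boundary regular fixed point\<close>

text \<open>Fekete's lemma: \<open>u n - c\<close> is superadditive, so the quotients converge to
  the supremum of \<open>(u n - c) / n\<close>, which is finite by the linear bound.\<close>

lemma superadditive_limit:
  fixes u :: "nat \<Rightarrow> real"
  assumes super: "\<And>m n. u m + u n - c \<le> u (m + n)" and bound: "\<And>n. u n \<le> K * real n" and c0: "c \<ge> 0"
  shows "convergent (\<lambda>n. u n / real n)"
proof -
  define S where "S = (SUP n\<in>{1..}. (u n - c) / real n)"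
  have bdd: "bdd_above ((\<lambda>n. (u n - c) / real n) ` {1..})"
  proof (rule bdd_aboveI2[of _ _ K])
    fix n :: nat assume "n \<in> {1..}"
    then show "(u n - c) / real n \<le> K" using bound[of n] c0 by (simp add: divide_le_eq)
  qed
  have upper: "u n \<le> S * real n + c" if "n \<ge> 1" for n
    using cSUP_upper[OF _ bdd, of n] that unfolding S_def by (auto simp: field_simps)
  have mult: "real k * (u n - c) + u r \<le> u (k * n + r)" for k n r
  proof (induction k)
    case (Suc k)
    then show ?case using super[of n "k * n + r"] by (simp add: algebra_simps)
  qed simp
  have "(\<lambda>n. u n / real n) \<longlonglongrightarrow> S"
  proof (rule LIMSEQ_I)
    fix e :: real assume "e > 0"
    then have "S - e / 2 < (SUP n\<in>{1..}. (u n - c) / real n)" by (simp add: S_def)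
    then obtain k where k: "k \<ge> 1" "S - e / 2 < (u k - c) / real k"
      using less_cSUP_iff[OF _ bdd, of "S - e / 2"] by auto
    \<comment> \<open>\<open>b\<close> controls the remainders modulo \<open>k\<close>, and
      \<open>d\<close> is a slope within \<open>e / 2\<close> of the supremum.\<close>
    define b where "b = Min (u ` {..<k})"
    define d where "d = (u k - c) / real k"
    have b: "b \<le> u r" if "r < k" for r using that by (auto simp: b_def)
    have lower: "d * real n - \<bar>d\<bar> * real k + b \<le> u n" for n
    proof -
      have "real (n div k) * (u k - c) = d * real n - d * real (n mod k)"
      proof -
        have "u k - c = d * real k" using k(1) by (simp add: d_def)
        moreover have "real n = real (n div k) * real k + real (n mod k)"
          by (simp flip: of_nat_mult of_nat_add)
        ultimately show ?thesis by (simp add: algebra_simps)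
      qed
      moreover have "d * real (n mod k) \<le> \<bar>d\<bar> * real k"
        using k(1) by (intro mult_mono) auto
      ultimately show ?thesis
        using mult[of "n div k" k "n mod k"] b[of "n mod k"] k(1) by simp
    qed
    \<comment> \<open>One half of \<open>e\<close> absorbs all bounded errors, the other half the
      gap between \<open>d\<close> and \<open>S\<close>.\<close>
    obtain N :: nat where N: "real N * (e / 2) > \<bar>d\<bar> * real k + \<bar>b\<bar> + c"
      using ex_less_of_nat_mult[OF half_gt_zero[OF \<open>e > 0\<close>]] by blast
    have "norm (u n / real n - S) < e" if n: "n \<ge> max N 1" for n
    proof -
      have Nn: "\<bar>d\<bar> * real k + \<bar>b\<bar> + c < real n * (e / 2)"
        using n \<open>e > 0\<close> by (intro less_le_trans[OF N] mult_right_mono) auto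
      have "S * real n - e / 2 * real n \<le> d * real n"
        using mult_right_mono[of "S - e / 2" d "real n"] k(2) by (simp add: d_def left_diff_distrib)
      then have "S * real n - e * real n < u n" using lower[of n] Nn c0 by (simp add: algebra_simps)
      moreover have "u n < S * real n + e * real n"
      proof -
        have "c \<le> \<bar>d\<bar> * real k + \<bar>b\<bar> + c" by simp
        then have "c < real n * (e / 2)" using Nn by linarith
        moreover have "real n * (e / 2) \<le> e * real n" using \<open>e > 0\<close> by simp
        ultimately show ?thesis using upper[of n] n by (simp add: mult.commute)
      qed
      ultimately show ?thesis using n by (simp add: abs_less_iff field_simps)
    qed
    then show "\<exists>no. \<forall>n\<ge>no. norm (u n / real n - S) < e" by blast
  qed
  then show ?thesis by (rule convergentI)
qed

section \<open>Displacement and dilation of the iterates along the ray\<close>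

locale ray_fixed_point = hyperbolic_ray X \<delta> \<gamma> \<eta>
  for X :: "'a::metric_space itself" and \<delta> \<gamma> \<eta> +
  fixes f :: "'a \<Rightarrow> 'a"
  assumes f: "non_expanding f" and brfp: "boundary_regular_fixed_point f \<eta>"
begin

lemma descent_ge: "- dist (f pt) pt \<le> descent f x"
proof -
  have "dist (f x) pt \<le> dist x pt + dist (f pt) pt"
    using non_expandingD[OF f, of x pt] dist_triangle[of "f x" pt "f pt"] by linarith
  then show ?thesis by (simp add: descent_def)
qed

lemma gromov_converges_ray: "gromov_converges (\<lambda>n. \<gamma> (real n)) (Inr \<eta>)"
  by (rule gromov_converges_near_ray[of real _ 0]) (auto simp: filterlim_real_sequentially)

lemma gromov_converges_image_ray: "gromov_converges (\<lambda>n. f (\<gamma> (real n))) (Inr \<eta>)"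
proof -
  have "\<gamma> (real n) \<in> geodesic_region \<gamma> 1" for n
    unfolding geodesic_region_def by simp
  then show ?thesis
    using brfp ray_mem gromov_converges_ray
    unfolding boundary_regular_fixed_point_def has_geodesic_limit_def
    by (metis zero_less_one)
qed

text \<open>Finite dilation and the geodesic limit of \<open>f\<close> both enter here. By
  non-expansion the bound passes to \<open>f ^^ n\<close> with factor \<open>n\<close>, which makes
  the dilations of all iterates finite and keeps the image of the ray tending to \<eta>.\<close>

lemma bounded_displacement_ex: "\<exists>M>0. \<forall>t\<ge>0. dist (f (\<gamma> t)) (\<gamma> t) \<le> M"
proof -
  have "ereal (- dist (f pt) pt) \<le> log_dilation pt \<eta> f"
    unfolding log_dilation_eq by (rule Liminf_bounded) (use descent_ge in simp)
  moreover have "log_dilation pt \<eta> f < \<infinity>"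
    using brfp by (simp add: boundary_regular_fixed_point_def)
  ultimately obtain L where L: "log_dilation pt \<eta> f = ereal L"
    by (cases "log_dilation pt \<eta> f") auto
  have esc: "\<exists>s\<ge>T. near_boundary pt r (f (\<gamma> s)) \<gamma>" for r T
  proof -
    obtain N where N: "\<And>n. n \<ge> N \<Longrightarrow> near_boundary pt r (f (\<gamma> (real n))) \<gamma>"
      using eventually_boundary_converges[OF gromov_converges_image_ray eventually_near_boundary]
      unfolding eventually_sequentially by blast
    obtain n :: nat where "T \<le> real n" using real_arch_simple by blast
    then show ?thesis using N[of "max n N"] by (intro exI[of _ "real (max n N)"]) auto
  qed
  have "dist (f (\<gamma> t)) (\<gamma> t) \<le> \<bar>2 * max L 0 + dist (f pt) pt + 8 * \<delta>\<bar> + 1" if "t \<ge> 0" for t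
    using dist_image_ray_le[OF f L that esc] descent_ge[of "\<gamma> t"] by linarith
  then show ?thesis by (intro exI[of _ "\<bar>2 * max L 0 + dist (f pt) pt + 8 * \<delta>\<bar> + 1"]) auto
qed

definition M where "M = (SOME M. M > 0 \<and> (\<forall>t\<ge>0. dist (f (\<gamma> t)) (\<gamma> t) \<le> M))"

lemma M: "M > 0" "t \<ge> 0 \<Longrightarrow> dist (f (\<gamma> t)) (\<gamma> t) \<le> M"
  using someI_ex[OF bounded_displacement_ex] unfolding M_def by auto

lemma dist_funpow_ray:
  assumes "t \<ge> 0"
  shows "dist ((f ^^ n) (\<gamma> t)) (\<gamma> t) \<le> real n * M"
proof (induction n)
  case (Suc n)
  have "dist ((f ^^ Suc n) (\<gamma> t)) (f (\<gamma> t)) \<le> dist ((f ^^ n) (\<gamma> t)) (\<gamma> t)"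
    using non_expandingD[OF f] by simp
  then show ?case
    using Suc M(2)[OF assms] dist_triangle[of "(f ^^ Suc n) (\<gamma> t)" "\<gamma> t" "f (\<gamma> t)"]
    by (simp add: algebra_simps)
qed simp

lemma descent_funpow_ray: "t \<ge> 0 \<Longrightarrow> descent (f ^^ n) (\<gamma> t) \<le> real n * M"
  using dist_funpow_ray[of t n] dist_triangle2[of "\<gamma> t" pt "(f ^^ n) (\<gamma> t)"]
    dist_triangle[of "\<gamma> t" pt "(f ^^ n) (\<gamma> t)"]
  unfolding descent_def by (simp add: dist_commute)

definition L :: "nat \<Rightarrow> real" where "L n = real_of_ereal (log_dilation pt \<eta> (f ^^ n))"

lemma log_dilation_funpow: "log_dilation pt \<eta> (f ^^ n) = ereal (L n)"
proof -
  have "- dist ((f ^^ n) pt) pt \<le> descent (f ^^ n) x" for x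
    using non_expandingD[OF non_expanding_funpow[OF f], of n x pt]
      dist_triangle[of "(f ^^ n) x" pt "(f ^^ n) pt"]
    unfolding descent_def by linarith
  from log_dilation_finite[OF this descent_funpow_ray] show ?thesis
    unfolding L_def by (auto simp: ereal_real)
qed

text \<open>Provides the hypothesis \<open>esc\<close> for the iterates: their images of ray points
  stay within \<open>n * M\<close> of the ray.\<close>

lemma near_boundary_funpow_ray: "\<exists>s\<ge>T. near_boundary pt r ((f ^^ n) (\<gamma> s)) \<gamma>"
proof -
  obtain R where R: "R \<ge> 0" "\<And>x t. t \<ge> R \<Longrightarrow> dist x (\<gamma> t) \<le> real n * M \<Longrightarrow> near_boundary pt r x \<gamma>"
    using eventually_near_ray[OF eventually_near_boundary] by blast
  then show ?thesis using dist_funpow_ray[of "max R T" n] by (intro exI[of _ "max R T"]) (auto intro!: R(2)[of "max R T"])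
qed

lemmas funpow_ray = non_expanding_funpow[OF f] log_dilation_funpow

lemma L_le: "L n \<le> real n * M"
proof -
  have "L n \<le> real n * M + e" if "e > 0" for e
  proof -
    have "\<forall>\<^sub>F z in boundary_filter. L n - e < descent (f ^^ n) z"
      by (rule eventually_descent_gt[OF log_dilation_funpow]) (use that in simp)
    then obtain R where "R \<ge> 0" "\<And>x t. t \<ge> R \<Longrightarrow> dist x (\<gamma> t) \<le> 0 \<Longrightarrow> L n - e < descent (f ^^ n) x"
      using eventually_near_ray[where C = 0] by blast
    then show ?thesis using descent_funpow_ray[of R n] by fastforce
  qed
  then show ?thesis by (rule field_le_epsilon)
qed

text \<open>Late on the ray the descent exceeds \<open>L n - 1\<close>, and
  \<open>2 * max (L n) 0 - L n\<close> equals \<open>\<bar>L n\<bar>\<close>. This sharpening of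
  \<open>n * M\<close> yields the upper bound for the backward step rate.\<close>

lemma eventually_dist_funpow_ray:
  "\<forall>\<^sub>F t in at_top. dist ((f ^^ n) (\<gamma> t)) (\<gamma> t) \<le> \<bar>L n\<bar> + 8 * \<delta> + 1"
proof -
  have "\<forall>\<^sub>F z in boundary_filter. L n - 1 < descent (f ^^ n) z"
    by (rule eventually_descent_gt[OF log_dilation_funpow]) simp
  then obtain R where R: "R \<ge> 0" "\<And>x t. t \<ge> R \<Longrightarrow> dist x (\<gamma> t) \<le> 0 \<Longrightarrow> L n - 1 < descent (f ^^ n) x"
    using eventually_near_ray[where C = 0] by blast
  have "dist ((f ^^ n) (\<gamma> t)) (\<gamma> t) \<le> \<bar>L n\<bar> + 8 * \<delta> + 1" if "t \<ge> R" for t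
    using dist_image_ray_le[OF funpow_ray _ near_boundary_funpow_ray, of t n] R(1) R(2)[of t "\<gamma> t"] that
    by (auto simp: max_def split: if_splits)
  then show ?thesis unfolding eventually_at_top_linorder by blast
qed

text \<open>The descent of \<open>f ^^ (m + n)\<close> at \<open>\<gamma> R\<close> is the sum of
  two descents taken at points within \<open>n * M\<close> of \<open>\<gamma> R\<close>, each almost
  bounded below by its lower limit. \<open>descent_ray_le\<close> bounds the sum from above.\<close>

lemma L_superadditive: "L m + L n - 2 * \<delta> \<le> L (m + n)"
proof (rule field_le_epsilon)
  fix e :: real assume "e > 0"
  have "\<forall>\<^sub>F z in boundary_filter. L n - e / 2 < descent (f ^^ n) z"
    "\<forall>\<^sub>F z in boundary_filter. L m - e / 2 < descent (f ^^ m) z"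
    by (rule eventually_descent_gt[OF log_dilation_funpow], use \<open>e > 0\<close> in simp)+
  then have "\<forall>\<^sub>F z in boundary_filter. L n - e / 2 < descent (f ^^ n) z \<and> L m - e / 2 < descent (f ^^ m) z"
    by (rule eventually_conj)
  then obtain R where R: "R \<ge> 0"
    "\<And>x t. t \<ge> R \<Longrightarrow> dist x (\<gamma> t) \<le> real n * M \<Longrightarrow>
      L n - e / 2 < descent (f ^^ n) x \<and> L m - e / 2 < descent (f ^^ m) x"
    using eventually_near_ray[where C = "real n * M"] by blast
  have "L n - e / 2 < descent (f ^^ n) (\<gamma> R)" "L m - e / 2 < descent (f ^^ m) ((f ^^ n) (\<gamma> R))"
    using R(2)[of R "\<gamma> R"] R(2)[OF _ dist_funpow_ray[OF R(1)]] M(1) by simp_all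
  moreover have "descent (f ^^ (m + n)) (\<gamma> R) \<le> L (m + n) + 2 * \<delta>"
    by (rule descent_ray_le[OF funpow_ray R(1)])
  ultimately show "L m + L n - 2 * \<delta> \<le> L (m + n) + e"
    by (simp add: descent_def funpow_add)
qed

lemma convergent_L: "convergent (\<lambda>n. L n / real n)"
  by (rule superadditive_limit[of L "2 * \<delta>" M]) (use L_superadditive L_le delta_pos in \<open>auto simp: mult.commute\<close>)

text \<open>A change of base point alters each logarithm by at most \<open>d\<close>, which
  disappears after division by \<open>n\<close>.\<close>

lemma log_dilation_tendsto:
  fixes p :: 'a
  shows "(\<lambda>n. log_dilation p \<eta> (f ^^ n) / ereal (real n)) \<longlonglongrightarrow> ereal (lim (\<lambda>n. L n / real n))"
proof -
  define d where "d = 2 * dist p pt"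
  define u where "u n = real_of_ereal (log_dilation p \<eta> (f ^^ n))" for n
  have bd: "log_dilation p \<eta> (f ^^ n) + ereal (- d) \<le> ereal (L n)"
    "ereal (L n) + ereal (- d) \<le> log_dilation p \<eta> (f ^^ n)" for n
    using log_dilation_basepoint[of "- d" p pt "f ^^ n"] log_dilation_basepoint[of "- d" pt p "f ^^ n"]
      log_dilation_funpow[of n] by (auto simp: d_def dist_commute)
  have u: "log_dilation p \<eta> (f ^^ n) = ereal (u n)" "\<bar>u n - L n\<bar> \<le> d" for n
    using bd[of n] unfolding u_def by (cases "log_dilation p \<eta> (f ^^ n)"; auto)+
  have "(\<lambda>n. (u n - L n) / real n) \<longlonglongrightarrow> 0"
  proof (rule Lim_null_comparison)
    show "\<forall>\<^sub>F n in sequentially. norm ((u n - L n) / real n) \<le> d * (1 / real n)"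
      using u(2) by (intro always_eventually allI) (auto simp: divide_right_mono)
    show "(\<lambda>n. d * (1 / real n)) \<longlonglongrightarrow> 0"
      using tendsto_mult_right_zero[OF lim_1_over_n, of d] by simp
  qed
  from tendsto_add[OF this convergent_L[unfolded convergent_LIMSEQ_iff]]
  have "(\<lambda>n. u n / real n) \<longlonglongrightarrow> lim (\<lambda>n. L n / real n)"
    by (simp add: diff_divide_distrib)
  then have "(\<lambda>n. ereal (u n / real n)) \<longlonglongrightarrow> ereal (lim (\<lambda>n. L n / real n))" by simp
  then show ?thesis
    by (rule Lim_transform_eventually)
      (use eventually_gt_at_top[of 0] in eventually_elim, simp add: u(1))
qed

lemma ln_stable_dilation: "ln (stable_dilation p \<eta> f) = lim (\<lambda>n. L n / real n)"
  unfolding stable_dilation_def using limI[OF log_dilation_tendsto] by simp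

end

section \<open>Extracting a backward orbit\<close>

text \<open>The diagonal argument through Tychonoff's theorem: the product of the \<open>K j\<close>
  is compact, and sequentially compact because the index set is countable.\<close>

lemma pointwise_convergent_subsequence:
  fixes w :: "nat \<Rightarrow> nat \<Rightarrow> 'a::metric_space"
  assumes "\<And>j. compact (K j)" and "\<And>N j. w N j \<in> K j"
  shows "\<exists>r x. strict_mono r \<and> (\<forall>j. (\<lambda>N. w (r N) j) \<longlonglongrightarrow> x j)"
proof -
  have "compactin (product_topology (\<lambda>_. euclidean) UNIV) (PiE UNIV K)"
    using assms(1) by (simp add: compactin_PiE)
  then have "compact (PiE UNIV K)" by (simp add: euclidean_product_topology)
  moreover have "\<And>N. w N \<in> PiE UNIV K" using assms(2) by auto
  ultimately obtain x r where r: "strict_mono r" "(w \<circ> r) \<longlonglongrightarrow> x"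
    using compact_imp_seq_compact seq_compactE by metis
  have "(\<lambda>N. w (r N) j) \<longlonglongrightarrow> x j" for j
    using continuous_on_tendsto_compose[OF continuous_on_product_coordinates[of j] r(2)]
    by (simp add: comp_def)
  with r(1) show ?thesis by blast
qed

lemma funpow_funpow: "(f ^^ m) ((f ^^ n) x) = (f ^^ (m + n)) x"
  by (simp add: funpow_add)

section \<open>Orbits of far points of the ray and their backward limit\<close>

context ray_fixed_point
begin

text \<open>The comparison point has the same distance from \<open>pt\<close> as \<open>z\<close>,
  so this distance also tells how far out on the ray it is.\<close>

definition close_to_ray :: "real \<Rightarrow> 'a \<Rightarrow> bool" where
  "close_to_ray C z \<longleftrightarrow> dist z (\<gamma> (dist z pt)) \<le> C"

text \<open>As long as the orbit of a point of the ray stays far out, it moves towards the base point by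
  almost the length of its steps. Its points then have large Gromov product with the starting
  point, so that the orbit cannot leave a neighbourhood of the ray.\<close>

lemma orbit_reaches_compact:
  assumes m: "L m \<ge> 2 + \<delta>"
  shows "\<exists>R T. \<forall>t\<ge>T. \<exists>k. dist ((f ^^ (m * k)) (\<gamma> t)) pt \<le> R \<and>
      (\<forall>i\<le>k. close_to_ray (12 * \<delta> + 2) ((f ^^ (m * i)) (\<gamma> t))) \<and>
      (\<forall>i<k. descent (f ^^ m) ((f ^^ (m * i)) (\<gamma> t)) \<ge> 1)"
proof -
  have "\<forall>\<^sub>F z in boundary_filter. L m - 1 < descent (f ^^ m) z"
    by (rule eventually_descent_gt[OF log_dilation_funpow]) simp
  then obtain R where R: "R \<ge> 0"
    "\<And>z t. t \<ge> R \<Longrightarrow> dist z (\<gamma> t) \<le> 12 * \<delta> + 2 \<Longrightarrow> L m - 1 < descent (f ^^ m) z"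
    using eventually_near_ray[where C = "12 * \<delta> + 2"] by blast
  obtain T where T: "\<And>t. t \<ge> T \<Longrightarrow> dist ((f ^^ m) (\<gamma> t)) (\<gamma> t) \<le> \<bar>L m\<bar> + 8 * \<delta> + 1"
    using eventually_dist_funpow_ray[of m] unfolding eventually_at_top_linorder by blast
  have "\<exists>k. dist ((f ^^ (m * k)) (\<gamma> t)) pt \<le> R \<and>
      (\<forall>i\<le>k. close_to_ray (12 * \<delta> + 2) ((f ^^ (m * i)) (\<gamma> t))) \<and>
      (\<forall>i<k. descent (f ^^ m) ((f ^^ (m * i)) (\<gamma> t)) \<ge> 1)" if t: "t \<ge> max T 0" for t
  proof -
    define y where "y i = (f ^^ (m * i)) (\<gamma> t)" for i
    define h where "h i = dist (y i) pt" for i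
    have ySuc: "(f ^^ m) (y i) = y (Suc i)" for i by (simp add: y_def funpow_add)
    \<comment> \<open>Both points are images under \<open>f ^^ (m * i)\<close> of the first two, so
      no step is longer than the first.\<close>
    have step: "dist (y i) (y (Suc i)) \<le> L m + 8 * \<delta> + 1" for i
    proof -
      have "y (Suc i) = (f ^^ (m * i)) ((f ^^ m) (\<gamma> t))"
        by (simp add: y_def funpow_funpow add.commute)
      then have "dist (y i) (y (Suc i)) \<le> dist (\<gamma> t) ((f ^^ m) (\<gamma> t))"
        using non_expandingD[OF funpow_ray(1)] by (simp add: y_def)
      then show ?thesis using T[of t] t m delta_pos by (simp add: dist_commute)
    qed
    have main: "t - real n \<ge> h n \<and> gromov_product pt (\<gamma> t) (y n) \<ge> h n - (5 * \<delta> + 1) \<and>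
        close_to_ray (12 * \<delta> + 2) (y n) \<and> (\<forall>i<n. descent (f ^^ m) (y i) \<ge> 1)"
      if "\<forall>i<n. h i \<ge> R" for n
      using that
    proof (induction n)
      case 0
      have "y 0 = \<gamma> t" by (simp add: y_def)
      moreover have "dist (\<gamma> t) pt = t" using ray_dist[of t 0] t by simp
      ultimately show ?case using delta_pos by (simp add: h_def gromov_product_def close_to_ray_def)
    next
      case (Suc n)
      then have IH: "t - real n \<ge> h n" "gromov_product pt (\<gamma> t) (y n) \<ge> h n - (5 * \<delta> + 1)"
        "close_to_ray (12 * \<delta> + 2) (y n)" "\<forall>i<n. descent (f ^^ m) (y i) \<ge> 1" and "h n \<ge> R"
        by auto
      have dec: "L m - 1 < h n - h (Suc n)"
        using R(2)[OF \<open>h n \<ge> R\<close>, of "y n"] IH(3)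
        unfolding close_to_ray_def descent_def ySuc h_def by simp
      have "gromov_product pt (y n) (y (Suc n)) \<ge> h (Suc n) - (4 * \<delta> + 1)"
        using dec step[of n] unfolding gromov_product_def h_def by argo
      \<comment> \<open>The drop in \<open>h\<close> by more than \<open>1 + \<delta>\<close> pays
        for the \<delta> of the four point inequality, so the error \<open>5 * \<delta> + 1\<close>
        does not accumulate. This is why \<open>L m\<close> must be at least
        \<open>2 + \<delta>\<close>.\<close>
      then have prod: "gromov_product pt (\<gamma> t) (y (Suc n)) \<ge> h (Suc n) - (5 * \<delta> + 1)"
        using four_point[of pt "\<gamma> t" "y n" "y (Suc n)"] IH(2) dec m delta_pos by linarith
      have h0: "0 \<le> h (Suc n)" by (simp add: h_def)
      have ht: "h (Suc n) \<le> t - real (Suc n)" using dec IH(1) m delta_pos by simp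
      let ?q = "\<gamma> (h (Suc n))"
      have "gromov_product pt ?q (\<gamma> t) = h (Suc n)" using ray_product h0 ht by simp
      then have "gromov_product pt ?q (y (Suc n)) \<ge> h (Suc n) - (6 * \<delta> + 1)"
        using four_point[of pt ?q "\<gamma> t" "y (Suc n)"] prod delta_pos by linarith
      moreover have "dist ?q pt = h (Suc n)" using ray_dist[of "h (Suc n)" 0] h0 by simp
      \<comment> \<open>Both points have height \<open>h (Suc n)\<close>, so the distance is at most
        twice the error \<open>6 * \<delta> + 1\<close>; this is the radius used in choosing
        \<open>R\<close>.\<close>
      ultimately have "dist ?q (y (Suc n)) \<le> 12 * \<delta> + 2"
        unfolding gromov_product_def h_def by argo
      then have "close_to_ray (12 * \<delta> + 2) (y (Suc n))"
        by (simp add: close_to_ray_def dist_commute h_def)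
      moreover have "descent (f ^^ m) (y n) \<ge> 1"
        using dec m delta_pos by (simp add: descent_def ySuc h_def)
      ultimately show ?case using prod ht IH(4) by (auto simp: less_Suc_eq)
    qed
    have "\<exists>n. h n \<le> R"
    proof (rule ccontr)
      assume "\<not> ?thesis"
      then have ge: "h n \<ge> R" for n by (meson less_le_not_le not_le)
      obtain n :: nat where "t < real n" using reals_Archimedean2 by blast
      with main[of n] ge have "h n < 0" by fastforce
      then show False by (simp add: h_def)
    qed
    \<comment> \<open>The first arrival in the ball of radius \<open>R\<close>; \<open>main\<close>
      applies up to and including this index.\<close>
    then obtain k where "h k \<le> R" "\<forall>i<k. h i \<ge> R"
      using exists_least_iff[of "\<lambda>n. h n \<le> R"] by (metis not_le less_imp_le)
    moreover have "close_to_ray (12 * \<delta> + 2) (y i)" if "i \<le> k" for i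
      using main[of i] \<open>\<forall>i<k. h i \<ge> R\<close> that by simp
    ultimately show ?thesis using main[of k] unfolding h_def y_def by (intro exI[of _ k]) simp
  qed
  then show ?thesis by blast
qed

lemma backward_orbit_exists:
  assumes proper: "proper_space TYPE('a)" and m: "L m \<ge> 2 + \<delta>"
  obtains x C where "backward_orbit f x" "\<And>j. dist (x j) (x (Suc j)) \<le> M"
    "\<And>j q. dist (x j) (x (j + q)) \<le> \<bar>L q\<bar> + 8 * \<delta> + 1"
    "\<And>j. close_to_ray C (x (m * j))" "\<And>j. dist (x (m * j)) pt \<ge> real j"
proof -
  define C where "C = 12 * \<delta> + 2"
  have "m > 0" using m log_dilation_funpow[of 0] L_le[of 0] delta_pos by (cases m) auto
  from orbit_reaches_compact[OF m, folded C_def]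
  obtain R T where RT: "\<forall>t\<ge>T. \<exists>k. dist ((f ^^ (m * k)) (\<gamma> t)) pt \<le> R \<and>
      (\<forall>i\<le>k. close_to_ray C ((f ^^ (m * i)) (\<gamma> t))) \<and>
      (\<forall>i<k. descent (f ^^ m) ((f ^^ (m * i)) (\<gamma> t)) \<ge> 1)"
    by (elim exE) (rule that)
  \<comment> \<open>A block of \<open>m\<close> iterations covers at most \<open>m * M\<close>, so
    this starting height forces at least \<open>N\<close> blocks before arrival.\<close>
  define t where "t N = \<bar>T\<bar> + \<bar>R\<bar> + real m * real N * M" for N :: nat
  have t: "t N \<ge> T" "t N \<ge> 0" for N
  proof -
    have "0 \<le> real m * real N * M" using M(1) by simp
    then show "t N \<ge> T" "t N \<ge> 0" by (simp_all add: t_def)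
  qed
  from RT t(1) have "\<forall>N. \<exists>k. dist ((f ^^ (m * k)) (\<gamma> (t N))) pt \<le> R \<and>
      (\<forall>i\<le>k. close_to_ray C ((f ^^ (m * i)) (\<gamma> (t N)))) \<and>
      (\<forall>i<k. descent (f ^^ m) ((f ^^ (m * i)) (\<gamma> (t N))) \<ge> 1)" by simp
  from choice[OF this] obtain k where k: "\<And>N. dist ((f ^^ (m * k N)) (\<gamma> (t N))) pt \<le> R"
    "\<And>N i. i \<le> k N \<Longrightarrow> close_to_ray C ((f ^^ (m * i)) (\<gamma> (t N)))"
    "\<And>N i. i < k N \<Longrightarrow> descent (f ^^ m) ((f ^^ (m * i)) (\<gamma> (t N))) \<ge> 1"
    by auto
  have kN: "N \<le> k N" for N
  proof -
    have "t N \<le> R + real (m * k N) * M"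
      using k(1)[of N] dist_funpow_ray[OF t(2), of "m * k N" N] ray_dist[of "t N" 0] t(2)[of N]
        dist_triangle[of "\<gamma> (t N)" pt "(f ^^ (m * k N)) (\<gamma> (t N))"]
      by (simp add: dist_commute)
    then have "real m * real N * M \<le> real m * real (k N) * M" by (simp add: t_def)
    then show ?thesis using M(1) \<open>m > 0\<close> by simp
  qed
  \<comment> \<open>The point \<open>j\<close> steps before arrival. Indices beyond the start get
    the value \<open>pt\<close>, which lies in every ball used for compactness; for fixed
    \<open>j\<close> this happens for finitely many \<open>N\<close> only, as
    \<open>N \<le> k N\<close>.\<close>
  define w where "w N j = (if j \<le> m * k N then (f ^^ (m * k N - j)) (\<gamma> (t N)) else pt)" for N j
  have f_w: "(f ^^ q) (w N (j + q)) = w N j" if "j + q \<le> m * k N" for N j q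
    using that by (simp add: w_def funpow_funpow)
  have w_step: "dist (w N j) (w N (j + q)) \<le> dist ((f ^^ q) (\<gamma> (t N))) (\<gamma> (t N))"
    if "j + q \<le> m * k N" for N j q
  proof -
    let ?i = "m * k N - (j + q)"
    \<comment> \<open>The pair is the image under \<open>f ^^ ?i\<close> of the displacement at the
      starting point.\<close>
    have "w N j = (f ^^ ?i) ((f ^^ q) (\<gamma> (t N)))"
      using that by (simp add: w_def funpow_funpow)
    then show ?thesis
      using that non_expandingD[OF funpow_ray(1), of ?i "(f ^^ q) (\<gamma> (t N))" "\<gamma> (t N)"]
      by (simp add: w_def)
  qed
  have w_bound: "dist pt (w N j) \<le> \<bar>R\<bar> + real j * M" for N j
  proof (cases "j \<le> m * k N")
    case True
    have "dist (w N 0) (w N j) \<le> real j * M"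
      using w_step[of 0 j N] dist_funpow_ray[OF t(2)[of N], of j] True by simp
    moreover have "dist (w N 0) pt \<le> R" using k(1)[of N] by (simp add: w_def)
    ultimately show ?thesis using dist_triangle[of pt "w N j" "w N 0"] by (simp add: dist_commute)
  qed (use M(1) in \<open>simp add: w_def\<close>)
  have "compact (cball pt (\<bar>R\<bar> + real j * M))" "w N j \<in> cball pt (\<bar>R\<bar> + real j * M)" for N j
    using proper w_bound unfolding proper_space_def by auto
  then obtain r x where r: "strict_mono r" and x: "\<And>j. (\<lambda>N. w (r N) j) \<longlonglongrightarrow> x j"
    using pointwise_convergent_subsequence[of "\<lambda>j. cball pt (\<bar>R\<bar> + real j * M)" w] by blast
  have ev: "\<forall>\<^sub>F N in sequentially. j \<le> k (r N)" for j
    using eventually_ge_at_top[of j]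
  proof eventually_elim
    case (elim N)
    then show ?case using seq_suble[OF r, of N] kN[of "r N"] by linarith
  qed
  have ev': "\<forall>\<^sub>F N in sequentially. j \<le> m * k (r N)" for j
    using ev[of j] by eventually_elim (use \<open>m > 0\<close> in \<open>auto intro: order_trans\<close>)
  have t_lim: "filterlim (\<lambda>N. t (r N)) at_top sequentially"
  proof -
    have "filterlim (\<lambda>N. real m * M * real N) at_top sequentially"
      using M(1) \<open>m > 0\<close> by (intro filterlim_tendsto_pos_mult_at_top[OF tendsto_const _ filterlim_real_sequentially]) auto
    then have "filterlim t at_top sequentially"
      by (rule filterlim_at_top_mono) (auto simp: t_def intro!: always_eventually)
    then show ?thesis using filterlim_compose filterlim_subseq[OF r] by blast
  qed
  have orbit: "f (x (Suc j)) = x j" for j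
  proof -
    have "continuous_on UNIV f"
      unfolding continuous_on_iff by (meson non_expandingD[OF f] order_le_less_trans)
    then have "isCont f (x (Suc j))" by (simp add: continuous_on_eq_continuous_at)
    then have "(\<lambda>N. f (w (r N) (Suc j))) \<longlonglongrightarrow> f (x (Suc j))"
      using x isCont_tendsto_compose by blast
    moreover have "\<forall>\<^sub>F N in sequentially. f (w (r N) (Suc j)) = w (r N) j"
      using ev'[of "Suc j"] by eventually_elim (use f_w[of _ 1] in simp)
    ultimately have "(\<lambda>N. w (r N) j) \<longlonglongrightarrow> f (x (Suc j))"
      by (rule Lim_transform_eventually)
    then show ?thesis using x LIMSEQ_unique by blast
  qed
  have dist_x: "dist (x j) (x (j + q)) \<le> c"
    if "\<forall>\<^sub>F N in sequentially. dist ((f ^^ q) (\<gamma> (t (r N)))) (\<gamma> (t (r N))) \<le> c" for j q c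
  proof (rule tendsto_upperbound[OF tendsto_dist[OF x x]])
    show "\<forall>\<^sub>F N in sequentially. dist (w (r N) j) (w (r N) (j + q)) \<le> c"
      using that ev'[of "j + q"] by eventually_elim (use w_step in \<open>blast intro: order_trans\<close>)
  qed simp
  have w_mult: "w (r N) (m * j) = (f ^^ (m * (k (r N) - j))) (\<gamma> (t (r N)))" if "j \<le> k (r N)" for N j
    using that by (simp add: w_def diff_mult_distrib2)
  have "continuous_on {0..} \<gamma>"
    unfolding continuous_on_iff using ray_dist by (metis atLeast_iff dist_real_def)
  then have ray_lim: "(\<lambda>N. \<gamma> (dist (w (r N) j) pt)) \<longlonglongrightarrow> \<gamma> (dist (x j) pt)" for j
    by (rule continuous_on_tendsto_compose) (auto intro!: tendsto_intros x)
  show thesis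
  proof (rule that)
    show "backward_orbit f x" using orbit by (simp add: backward_orbit_def)
    show "dist (x j) (x (Suc j)) \<le> M" for j
      using dist_x[of 1 M j] M(2) t(2) by simp
    show "dist (x j) (x (j + q)) \<le> \<bar>L q\<bar> + 8 * \<delta> + 1" for j q
      \<comment> \<open>The starting parameters tend to infinity, so the eventual displacement bound
        on the ray applies.\<close>
      by (rule dist_x, rule eventually_compose_filterlim[OF eventually_dist_funpow_ray t_lim])
    show "close_to_ray C (x (m * j))" for j
      unfolding close_to_ray_def
    proof (rule tendsto_upperbound[OF tendsto_dist[OF x ray_lim]])
      show "\<forall>\<^sub>F N in sequentially. dist (w (r N) (m * j)) (\<gamma> (dist (w (r N) (m * j)) pt)) \<le> C"
        using ev[of j] by eventually_elim (use k(2) w_mult in \<open>simp add: close_to_ray_def\<close>)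
    qed simp
    have inc: "dist (x (m * j)) pt + 1 \<le> dist (x (m * Suc j)) pt" for j
    proof (rule tendsto_le[OF sequentially_bot tendsto_dist[OF x tendsto_const]
          tendsto_add[OF tendsto_dist[OF x tendsto_const] tendsto_const]])
      show "\<forall>\<^sub>F N in sequentially. dist (w (r N) (m * j)) pt + 1 \<le> dist (w (r N) (m * Suc j)) pt"
        using ev[of "Suc j"]
      proof eventually_elim
        case (elim N)
        let ?i = "k (r N) - Suc j"
        \<comment> \<open>\<open>Suc j\<close> blocks before arrival the orbit index is strictly
          below \<open>k (r N)\<close>, where the descent bound holds.\<close>
        have "descent (f ^^ m) (w (r N) (m * Suc j)) \<ge> 1"
          using k(3)[of ?i "r N"] w_mult[OF elim] elim by simp
        moreover have "(f ^^ m) (w (r N) (m * Suc j)) = w (r N) (m * j)"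
          using f_w[of "m * j" m "r N"] mult_le_mono2[OF elim, of m] by (simp add: add.commute)
        ultimately show ?case by (simp add: descent_def)
      qed
    qed
    show "dist (x (m * j)) pt \<ge> real j" for j
    proof (induction j)
      case (Suc j)
      then show ?case using inc[of j] by simp
    qed simp
  qed
qed

text \<open>Only every \<open>m\<close>-th point is known to be near the ray; the others are fewer
  than \<open>m\<close> bounded steps away from such a point.\<close>

lemma backward_orbit_converges:
  assumes step: "\<And>j. dist (x j) (x (Suc j)) \<le> c" and "m > 0"
    and close: "\<And>j. close_to_ray C (x (m * j))" and dist: "\<And>j. dist (x (m * j)) pt \<ge> real j"
  shows "gromov_converges x (Inr \<eta>)"
proof -
  have c0: "c \<ge> 0" using step[of 0] zero_le_dist order_trans by blast
  have steps: "dist (x j) (x (j + q)) \<le> real q * c" for j q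
  proof (induction q)
    case (Suc q)
    then show ?case
      using step[of "j + q"] dist_triangle[of "x j" "x (j + Suc q)" "x (j + q)"]
      by (simp add: algebra_simps)
  qed simp
  define s where "s n = dist (x (m * (n div m))) pt" for n
  have "dist (x n) (\<gamma> (s n)) \<le> C + real m * c" for n
  proof -
    have "dist (x (m * (n div m))) (x n) \<le> real (n mod m) * c"
      using steps[of "m * (n div m)" "n mod m"] by simp
    also have "\<dots> \<le> real m * c" using c0 \<open>m > 0\<close> by (intro mult_right_mono) auto
    finally show ?thesis
      using close[of "n div m"] dist_triangle3[of "x n" "\<gamma> (s n)" "x (m * (n div m))"]
      unfolding s_def close_to_ray_def by linarith
  qed
  moreover have "filterlim s at_top sequentially"
  proof (rule filterlim_at_top_mono[of "\<lambda>n. real (n div m)"])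
    have "filterlim (\<lambda>n. n div m) sequentially sequentially"
      unfolding filterlim_at_top
    proof
      fix Z :: nat
      show "\<forall>\<^sub>F n in sequentially. Z \<le> n div m"
        using eventually_ge_at_top[of "Z * m"]
        by eventually_elim (use \<open>m > 0\<close> in \<open>simp add: less_eq_div_iff_mult_less_eq\<close>)
    qed
    then show "filterlim (\<lambda>n. real (n div m)) at_top sequentially"
      by (rule filterlim_compose[OF filterlim_real_sequentially])
    show "\<forall>\<^sub>F n in sequentially. real (n div m) \<le> s n" using dist by (simp add: s_def)
  qed
  ultimately show ?thesis by (rule gromov_converges_near_ray[rotated])
qed

text \<open>By non-expansion the distances increase with \<open>n\<close>. Each is at least the
  descent of \<open>f ^^ q\<close> at \<open>x (n + q)\<close>, and these points tend to \<eta>, so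
  the lower limit defining \<open>L q\<close> bounds the limit from below.\<close>

lemma backward_step_bounds:
  assumes orbit: "backward_orbit f x" and conv: "gromov_converges x (Inr \<eta>)"
    and bound: "\<And>j. dist (x j) (x (j + q)) \<le> c"
  shows "L q \<le> backward_step x q" "backward_step x q \<le> c"
proof -
  let ?s = "\<lambda>n. dist (x n) (x (n + q))"
  have "?s n \<le> ?s (Suc n)" for n
    using orbit non_expandingD[OF f, of "x (Suc n)" "x (Suc n + q)"] by (simp add: backward_orbit_def)
  then have "incseq ?s" by (rule incseq_SucI)
  moreover have "bdd_above (range ?s)" using bound by (intro bdd_aboveI) auto
  ultimately have "?s \<longlonglongrightarrow> (SUP n. ?s n)" by (rule LIMSEQ_incseq_SUP[rotated])
  then have lim: "?s \<longlonglongrightarrow> backward_step x q" unfolding backward_step_def by (metis limI)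
  from tendsto_upperbound[OF lim always_eventually] bound show "backward_step x q \<le> c" by simp
  show "L q \<le> backward_step x q"
  proof (rule field_le_epsilon)
    fix e :: real assume "e > 0"
    have "L q - e \<le> backward_step x q"
    proof (rule tendsto_lowerbound[OF lim])
      have fq: "(f ^^ q) (x (n + q)) = x n" for n
        using orbit by (induction q) (auto simp: backward_orbit_def funpow_swap1)
      have "\<forall>\<^sub>F z in boundary_filter. L q - e < descent (f ^^ q) z"
        by (rule eventually_descent_gt[OF log_dilation_funpow]) (use \<open>e > 0\<close> in simp)
      from eventually_boundary_converges[OF limitin_sequentially_offset[OF conv, of q] this]
      show "\<forall>\<^sub>F n in sequentially. L q - e \<le> dist (x n) (x (n + q))"
      proof eventually_elim
        case (elim n)
        then show ?case
          using dist_triangle3[of "x (n + q)" pt "x n"] by (simp add: descent_def fq dist_commute)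
      qed
    qed simp
    then show "L q \<le> backward_step x q + e" by simp
  qed
qed

lemma repelling_backward_orbit:
  assumes proper: "proper_space TYPE('a)" and pos: "lim (\<lambda>n. L n / real n) > 0"
  shows "\<exists>x. backward_orbit f x \<and> bounded_step x \<and> gromov_converges x (Inr \<eta>) \<and>
    backward_step_rate x = lim (\<lambda>n. L n / real n)"
proof -
  define l where "l = lim (\<lambda>n. L n / real n)"
  have lim: "(\<lambda>n. L n / real n) \<longlonglongrightarrow> l"
    using convergent_L by (simp add: l_def convergent_LIMSEQ_iff)
  have "\<forall>\<^sub>F n in sequentially. l / 2 < L n / real n"
    using order_tendstoD(1)[OF lim, of "l / 2"] pos by (simp add: l_def)
  then obtain N where N: "\<And>n. n \<ge> N \<Longrightarrow> l / 2 < L n / real n"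
    unfolding eventually_sequentially by blast
  have Lpos: "l / 2 * real n \<le> L n" if "n \<ge> max N 1" for n
    using N[of n] that by (simp add: field_simps)
  \<comment> \<open>Positivity of \<open>l\<close> makes \<open>L\<close> grow at least with slope
    \<open>l / 2\<close>, so some iterate beats the hyperbolicity constant.\<close>
  obtain k :: nat where k: "2 + \<delta> < real k * (l / 2)"
    using ex_less_of_nat_mult[of "l / 2" "2 + \<delta>"] pos unfolding l_def by auto
  define m where "m = max k (max N 1)"
  have "real k * (l / 2) \<le> real m * (l / 2)" using pos by (intro mult_right_mono) (auto simp: m_def l_def)
  then have m: "L m \<ge> 2 + \<delta>" "m > 0" using k Lpos[of m] by (auto simp: m_def mult.commute)
  obtain x C where x: "backward_orbit f x" "\<And>j. dist (x j) (x (Suc j)) \<le> M"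
    "\<And>j q. dist (x j) (x (j + q)) \<le> \<bar>L q\<bar> + 8 * \<delta> + 1"
    "\<And>j. close_to_ray C (x (m * j))" "\<And>j. dist (x (m * j)) pt \<ge> real j"
    using backward_orbit_exists[OF proper m(1)] by blast
  have conv: "gromov_converges x (Inr \<eta>)"
    by (rule backward_orbit_converges[OF x(2) m(2) x(4,5)])
  note bounds = backward_step_bounds[OF x(1) conv x(3)]
  have "(\<lambda>q. backward_step x q / real q) \<longlonglongrightarrow> l"
  proof (rule tendsto_sandwich[OF _ _ lim])
    show "\<forall>\<^sub>F q in sequentially. L q / real q \<le> backward_step x q / real q"
      using bounds(1) by (intro always_eventually allI divide_right_mono) auto
    show "\<forall>\<^sub>F q in sequentially. backward_step x q / real q \<le> L q / real q + (8 * \<delta> + 1) * (1 / real q)"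
      using eventually_ge_at_top[of "max N 1"]
    proof eventually_elim
      case (elim q)
      have "0 \<le> l / 2 * real q" using pos by (simp add: l_def)
      \<comment> \<open>Only now do the two bounds differ by a constant, so that both quotients have
        the limit \<open>l\<close>.\<close>
      then have "\<bar>L q\<bar> = L q" using Lpos[OF elim] by linarith
      then have "backward_step x q / real q \<le> (L q + (8 * \<delta> + 1)) / real q"
        using bounds(2)[of q] by (intro divide_right_mono) auto
      then show ?case by (simp add: add_divide_distrib)
    qed
    show "(\<lambda>q. L q / real q + (8 * \<delta> + 1) * (1 / real q)) \<longlonglongrightarrow> l"
      using tendsto_add[OF lim tendsto_mult_right_zero[OF lim_1_over_n, of "8 * \<delta> + 1"]] by simp
  qed
  then have "backward_step_rate x = l" unfolding backward_step_rate_def by (rule limI)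
  moreover have "bounded_step x" unfolding bounded_step_def using x(2) by (intro bdd_aboveI) auto
  ultimately show ?thesis using x(1) conv unfolding l_def by blast
qed

end

theorem theorem1p5:
  fixes f :: "'a::metric_space \<Rightarrow> 'a"
    and \<eta> :: "(real \<Rightarrow> 'a) set"
    and p :: 'a
  assumes "proper_space TYPE('a)"
    and "geodesic_space TYPE('a)"
    and "gromov_hyperbolic TYPE('a)"
    and "non_expanding f"
    and "\<eta> \<in> gromov_boundary"
    and "boundary_regular_fixed_point f \<eta>"
    and "stable_dilation p \<eta> f > 1"
  shows "\<exists>x. backward_orbit f x \<and> bounded_step x \<and>
           gromov_converges x (Inr \<eta>) \<and>
           backward_step_rate x = ln (stable_dilation p \<eta> f)"
proof -
  obtain \<delta> where \<delta>: "\<delta> > 0" "delta_hyperbolic TYPE('a) \<delta>"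
    using assms(3) unfolding gromov_hyperbolic_def by blast
  obtain \<gamma> where \<gamma>: "\<gamma> \<in> \<eta>" using gromov_boundary_nonempty[OF assms(5)] by blast
  \<comment> \<open>The factor 3 comes from \<open>four_point_inequality\<close>.\<close>
  interpret ray_fixed_point "TYPE('a)" "3 * \<delta>" \<gamma> \<eta> f
    using four_point_inequality[OF assms(2) \<delta>(2,1)] \<delta>(1) \<gamma> assms(4-6) by unfold_locales auto
  have "lim (\<lambda>n. L n / real n) > 0"
    using assms(7) ln_stable_dilation[of p] ln_gt_zero by metis
  from repelling_backward_orbit[OF assms(1) this] show ?thesis
    by (simp only: ln_stable_dilation)
qed

end
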